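(* Let $\lambda=0$ and fix $i\in\{1,\dots,n\}$. Consider the forms in $\Omega^1_0( *D)(E)$ $$\varphi_{i0}=du,\quad \varphi_{ii}=\rho'(u-t_i)\,du,\quad \varphi_{ij}=\big(\rho(u-t_j)-\rho(u-t_i)\big)du\ \ (j\ne i),$$ each equal to its own dual ($\varphi^\vee=\varphi$, as they do not depend on the parameters). Put $\alpha_0^{(i)}=2\pi\sqrt{-1}c_0+\sum_{l\neq i}c_l\rho(t_i-t_l)$. Then for $j,k\in\{1,\dots,n\}\setminus\{i\}$: $$I_c([\varphi_{i0}],[\varphi_{ij}^\vee])=I_c([\varphi_{ij}],[\varphi_{i0}^\vee])=0,\qquad I_c([\varphi_{ij}],[\varphi_{ik}^\vee])=2\pi\sqrt{-1}\Big(\frac1{c_i}+\frac{\delta_{jk}}{c_j}\Big),$$ $$I_c([\varphi_{ii}],[\varphi_{i0}^\vee])=-\frac{2\pi\sqrt{-1}}{c_i-1},$$ $$I_c([\varphi_{ii}],[\varphi_{ii}^\vee])=\frac{2\pi\sqrt{-1}}{(c_i-1)(c_i+1)}\Big(\frac{(\alpha_0^{(i)})^2}{c_i}-c_i\frac{\vartheta_1'''(0)}{\vartheta_1'(0)}-\sum_{l\ne i}c_l\rho'(t_i-t_l)\Big),$$ $$I_c([\varphi_{ii}],[\varphi_{ij}^\vee])=-\frac{2\pi\sqrt{-1}}{c_i(c_i-1)}\Big(\alpha_0^{(i)}+c_i\rho(t_i-t_j)\Big).$$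
   Context: Fix $\tau$ in the upper half plane, $\Lambda=\mathbb{Z}+\mathbb{Z}\tau$, $E=\mathbb{C}/\Lambda$. Let $\vartheta_1(u)=-\sum_{m\in\mathbb{Z}}\exp\big(\pi\sqrt{-1}(m+\tfrac12)^2\tau+2\pi\sqrt{-1}(m+\tfrac12)(u+\tfrac12)\big)$, $\rho(u)=\vartheta_1'(u)/\vartheta_1(u)$. Let $n\ge2$, $t_1,\dots,t_n\in\mathbb{C}$ pairwise incongruent modulo $\Lambda$, $D=\{t_j\}\subset E$, $M=E\setminus D$. Let $c_0\in\mathbb{C}$, $c_1,\dots,c_n\in\mathbb{C}\setminus\mathbb{Z}$ with $\sum_{j\ge1}c_j=0$, $\omega=\big(2\pi\sqrt{-1}c_0+\sum_j c_j\rho(u-t_j)\big)du$. $\Omega^1_0( *D)(E)$ is the space of $f\,du$ with $f$ meromorphic and $\Lambda$-periodic on $\mathbb{C}$ with poles only in $\{t_j\}+\Lambda$; $\mathcal{O}_0( *D)(E)$ the analogous functions; $\nabla f=df+f\omega$, $\nabla^\vee f=df-f\omega$; $H^1(M;\mathcal{L}_0)=\Omega^1_0( *D)(E)/\nabla\mathcal{O}_0( *D)(E)$, $H^1(M;\mathcal{L}^\vee_0)=\Omega^1_0( *D)(E)/\nabla^\vee\mathcal{O}_0( *D)(E)$. The intersection form $I_c$ on $H^1(M;\mathcal{L}_0)\times H^1(M;\mathcal{L}^\vee_0)$ is $I_c([\varphi],[\varphi'])=\int_\Pi\varphi_1\wedge\varphi'$, where $\Pi$ is a fundamental parallelogram and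 $\varphi_1=\varphi-(dF+F\omega)$ is a smooth form vanishing near $\{t_j\}+\Lambda$ with $F$ smooth and $\Lambda$-periodic on $\mathbb{C}\setminus(\{t_j\}+\Lambda)$. Equivalently $I_c([\varphi],[\varphi'])=2\pi\sqrt{-1}\sum_j\operatorname{Res}_{u=t_j}(f_j\varphi')$, where $f_j$ is the unique meromorphic solution near $t_j$ of $df_j+f_j\omega=\varphi$. *)

theory Defs
  imports "HOL-Complex_Analysis.Complex_Analysis"
begin

definition theta1 :: "complex \<Rightarrow> complex \<Rightarrow> complex" where
  "theta1 \<tau> u = - (\<Sum>\<^sub>\<infinity>m::int. exp (pi * \<i> * (of_int m + 1/2)^2 * \<tau>
                      + 2 * pi * \<i> * (of_int m + 1/2) * (u + 1/2)))"

definition rho :: "complex \<Rightarrow> complex \<Rightarrow> complex" where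
  "rho \<tau> u = deriv (theta1 \<tau>) u / theta1 \<tau> u"

definition lattice :: "complex \<Rightarrow> complex set" where
  "lattice \<tau> = {of_int a + of_int b * \<tau> | a b. True}"

text \<open>Coefficient of the connection form omega = w(u) du.\<close>
definition omega_coef :: "complex \<Rightarrow> nat \<Rightarrow> (nat \<Rightarrow> complex) \<Rightarrow> complex \<Rightarrow> (nat \<Rightarrow> complex)
    \<Rightarrow> complex \<Rightarrow> complex" where
  "omega_coef \<tau> n t c0 c u = 2 * pi * \<i> * c0 + (\<Sum>l=1..n. c l * rho \<tau> (u - t l))"

text \<open>f is a meromorphic solution near p of  df + f omega = g du,
  i.e. f' + w f = g on a punctured disc around p, f having a non-essential singularity at p.\<close>
definition local_solution :: "(complex \<Rightarrow> complex) \<Rightarrow> (complex \<Rightarrow> complex)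
    \<Rightarrow> (complex \<Rightarrow> complex) \<Rightarrow> complex \<Rightarrow> bool" where
  "local_solution w g f p \<longleftrightarrow>
     (\<exists>r>0. \<forall>u \<in> ball p r - {p}. (f has_field_derivative (g u - w u * f u)) (at u))
     \<and> not_essential f p"

text \<open>Intersection form I_c([g du],[g' du]) = 2 pi i sum_j Res_{u=t_j}(f_j g' du),
  f_j the (unique) meromorphic local solution of df_j + f_j omega = g du near t_j.\<close>
definition Ic :: "complex \<Rightarrow> nat \<Rightarrow> (nat \<Rightarrow> complex) \<Rightarrow> complex \<Rightarrow> (nat \<Rightarrow> complex)
    \<Rightarrow> (complex \<Rightarrow> complex) \<Rightarrow> (complex \<Rightarrow> complex) \<Rightarrow> complex" where
  "Ic \<tau> n t c0 c g g' = 2 * pi * \<i> * (\<Sum>j=1..n.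
      (THE r. \<exists>f. local_solution (omega_coef \<tau> n t c0 c) g f (t j)
                  \<and> residue (\<lambda>u. f u * g' u) (t j) = r))"

end

theory Submission
  imports Defs
begin

unbundle fps_syntax

text \<open>
  Near \<open>t\<^sub>j\<close> the connection coefficient is \<open>w = c\<^sub>j / z + w\<^sub>0 + w\<^sub>1 z + \<dots>\<close> because \<open>\<theta>\<^sub>1\<close> vanishes to
  first order at \<open>0\<close> and nowhere off the lattice. Comparing Laurent coefficients in \<open>f' + w f = g\<close>
  gives \<open>(m + c\<^sub>j) f\<^sub>m = g\<^sub>m\<^sub>-\<^sub>1 - \<Sum>\<^sub>a\<^sub>\<ge>\<^sub>0 w\<^sub>a f\<^sub>m\<^sub>-\<^sub>1\<^sub>-\<^sub>a\<close>; as \<open>c\<^sub>j\<close> is not an integer this has a unique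
  solution, and for forms with poles of order at most two only \<open>f\<^sub>-\<^sub>1, f\<^sub>0, f\<^sub>1\<close> enter the residue.

  The zeros of \<open>\<theta>\<^sub>1\<close> are counted by the argument principle on a rectangle with sides \<open>1\<close> and
  \<open>Im \<tau>\<close>: although the upper side is not the translate of the lower one by \<open>\<tau>\<close>, the function \<open>\<rho>\<close> has
  period 1, so its integral over a horizontal unit segment does not change under the shift by \<open>Re \<tau>\<close>.
\<close>

section \<open>The theta function as an entire function\<close>

text \<open>With \<open>z = exp (2 * pi * \<i> * u)\<close>, the terms of the theta series with
  \<open>m >= 0\<close> are \<open>exp (pi * \<i> * u)\<close> times a power series in
  \<open>z\<close>. These are its coefficients.\<close>

definition theta_coeff :: "complex \<Rightarrow> nat \<Rightarrow> complex" where
  "theta_coeff \<tau> k = exp (pi * \<i> * (of_nat k + 1/2)^2 * \<tau> + pi * \<i> * (of_nat k + 1/2))"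

definition theta_half :: "complex \<Rightarrow> complex \<Rightarrow> complex" where
  "theta_half \<tau> = eval_fps (Abs_fps (theta_coeff \<tau>))"

lemma norm_theta_coeff:
  "norm (theta_coeff \<tau> k) = exp (- pi * (real k + 1/2)^2 * Im \<tau>)"
proof -
  have "(of_nat k + 1/2 :: complex)^2 = of_real ((real k + 1/2)^2)"
    by simp
  thus ?thesis
    unfolding theta_coeff_def norm_exp_eq_Re by (simp add: algebra_simps)
qed

text \<open>Consecutive moduli have the quotient \<open>exp (pi * Im \<tau> * (2 * n + 2))\<close>,
  which tends to infinity, so the ratio test applies.\<close>

lemma fps_conv_radius_theta_coeff:
  assumes "Im \<tau> > 0"
  shows   "fps_conv_radius (Abs_fps (theta_coeff \<tau>)) = \<infinity>"
proof -
  have "(\<lambda>n. ereal (norm (theta_coeff \<tau> n) / norm (theta_coeff \<tau> (Suc n)))) =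
          (\<lambda>n. ereal (exp (pi * Im \<tau> * (2 * real n + 2))))"
  proof
    fix n
    show "ereal (norm (theta_coeff \<tau> n) / norm (theta_coeff \<tau> (Suc n))) =
            ereal (exp (pi * Im \<tau> * (2 * real n + 2)))"
      unfolding norm_theta_coeff exp_diff [symmetric]
      by (simp add: algebra_simps power2_eq_square)
  qed
  moreover have "filterlim (\<lambda>n::nat. exp (pi * Im \<tau> * (2 * real n + 2))) at_top sequentially"
  proof (rule filterlim_compose[OF exp_at_top])
    have "filterlim (\<lambda>n::nat. 2 * real n + 2) at_top sequentially"
      by real_asymp
    with assms show "filterlim (\<lambda>n::nat. pi * Im \<tau> * (2 * real n + 2)) at_top sequentially"
      by (intro filterlim_tendsto_pos_mult_at_top[OF tendsto_const]) auto
  qed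
  hence "(\<lambda>n. ereal (exp (pi * Im \<tau> * (2 * real n + 2)))) \<longlonglongrightarrow> \<infinity>"
    by (simp add: tendsto_PInfty_eq_at_top)
  ultimately show ?thesis
    unfolding fps_conv_radius_def fps_nth_Abs_fps
    by (intro conv_radius_ratio_limit_ereal) (auto simp: theta_coeff_def)
qed

lemma theta_half_holomorphic:
  assumes "Im \<tau> > 0"
  shows   "theta_half \<tau> holomorphic_on UNIV"
  unfolding theta_half_def
  by (rule holomorphic_on_eval_fps) (simp add: fps_conv_radius_theta_coeff[OF assms])

lemma theta_half_has_sum:
  assumes "Im \<tau> > 0"
  shows   "((\<lambda>k. theta_coeff \<tau> k * z ^ k) has_sum theta_half \<tau> z) UNIV"
proof (rule norm_summable_imp_has_sum)
  have *: "ereal (norm z) < fps_conv_radius (Abs_fps (theta_coeff \<tau>))"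
    by (simp add: fps_conv_radius_theta_coeff[OF assms])
  show "summable (\<lambda>k. norm (theta_coeff \<tau> k * z ^ k))"
    using norm_summable_fps[OF *] by simp
  show "(\<lambda>k. theta_coeff \<tau> k * z ^ k) sums theta_half \<tau> z"
    using summable_fps[OF *] by (simp add: theta_half_def eval_fps_def summable_sums)
qed

text \<open>The reflection \<open>m -> -1 - m\<close> swaps the two halves of the integers and fixes
  \<open>(m + 1/2)^2\<close>; the offset 1/2 in \<open>u + 1/2\<close> produces the sign -1.
  Holomorphy, oddness and the behaviour under \<open>u + 1\<close> can be read off this
  form.\<close>

lemma theta1_eq:
  assumes "Im \<tau> > 0"
  shows "theta1 \<tau> u = exp (- (pi * \<i> * u)) * theta_half \<tau> (exp (- (2 * pi * \<i> * u)))
                     - exp (pi * \<i> * u) * theta_half \<tau> (exp (2 * pi * \<i> * u))"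
proof -
  define T where "T = (\<lambda>m::int. exp (pi * \<i> * (of_int m + 1/2)^2 * \<tau>
                      + 2 * pi * \<i> * (of_int m + 1/2) * (u + 1/2)))"
  have T_nat: "T (int k) = exp (pi * \<i> * u) * (theta_coeff \<tau> k * exp (2 * pi * \<i> * u) ^ k)" for k
    unfolding T_def theta_coeff_def exp_of_nat_mult [symmetric] exp_add [symmetric]
    by (rule arg_cong[of _ _ exp]) (simp add: field_simps power2_eq_square)
  have neg: "exp (- (pi * \<i> * (2 * of_nat k + 1))) = -(1::complex)" for k
  proof -
    have "exp (- (pi * \<i> * (2 * of_nat k + 1))) = exp (2 * of_int (-int k) * pi * \<i>) * exp (-(pi * \<i>))"
      unfolding exp_add [symmetric] by (rule arg_cong[of _ _ exp]) (simp add: algebra_simps)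
    moreover have "exp (2 * of_int (-int k) * pi * \<i>) = 1"
      by (rule exp_integer_2pi) auto
    ultimately show ?thesis by (simp add: exp_minus)
  qed
  have T_neg: "T (- 1 - int k) =
        - (exp (- (pi * \<i> * u)) * (theta_coeff \<tau> k * exp (- (2 * pi * \<i> * u)) ^ k))" for k
  proof -
    have "T (- 1 - int k) = exp (- (pi * \<i> * u)) * (theta_coeff \<tau> k * exp (- (2 * pi * \<i> * u)) ^ k)
             * exp (- (pi * \<i> * (2 * of_nat k + 1)))"
      unfolding T_def theta_coeff_def exp_of_nat_mult [symmetric] exp_add [symmetric]
      by (rule arg_cong[of _ _ exp]) (simp add: field_simps power2_eq_square)
    thus ?thesis by (simp only: neg mult_minus1_right)
  qed
  have 1: "(T has_sum (exp (pi * \<i> * u) * theta_half \<tau> (exp (2 * pi * \<i> * u)))) (range int)"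
    by (subst has_sum_reindex)
       (auto simp: o_def T_nat intro!: has_sum_cmult_right theta_half_has_sum assms)
  have 2: "(T has_sum - (exp (- (pi * \<i> * u)) * theta_half \<tau> (exp (- (2 * pi * \<i> * u)))))
             (range (\<lambda>k. -1 - int k))"
    by (subst has_sum_reindex)
       (auto simp: o_def T_neg inj_on_def
             intro!: has_sum_uminus[THEN iffD2] has_sum_cmult_right theta_half_has_sum assms)
  have "range int \<union> range (\<lambda>k. -1 - int k) = UNIV"
  proof -
    have "m \<in> range int \<union> range (\<lambda>k. -1 - int k)" for m
    proof (cases "m \<ge> 0")
      case True
      thus ?thesis by (auto intro: range_eqI[of _ _ "nat m"])
    next
      case False
      thus ?thesis by (intro UnI2 range_eqI[of _ _ "nat (-1 - m)"]) auto
    qed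
    thus ?thesis by blast
  qed
  moreover have "range int \<inter> range (\<lambda>k. -1 - int k) = {}" by auto
  ultimately have "(T has_sum (exp (pi * \<i> * u) * theta_half \<tau> (exp (2 * pi * \<i> * u)) +
           - (exp (- (pi * \<i> * u)) * theta_half \<tau> (exp (- (2 * pi * \<i> * u)))))) UNIV"
    using has_sum_Un_disjoint[OF 1 2] by simp
  hence "infsum T UNIV = exp (pi * \<i> * u) * theta_half \<tau> (exp (2 * pi * \<i> * u)) +
           - (exp (- (pi * \<i> * u)) * theta_half \<tau> (exp (- (2 * pi * \<i> * u))))"
    by (rule infsumI)
  thus ?thesis unfolding theta1_def T_def by simp
qed

lemma theta1_holomorphic:
  assumes "Im \<tau> > 0"
  shows   "theta1 \<tau> holomorphic_on A"
proof -
  have *: "(\<lambda>u. theta_half \<tau> (g u)) holomorphic_on UNIV" if "g holomorphic_on UNIV" for g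
    using holomorphic_on_compose_gen[OF that theta_half_holomorphic[OF assms]] by (simp add: o_def)
  have "(\<lambda>u. exp (- (pi * \<i> * u)) * theta_half \<tau> (exp (- (2 * pi * \<i> * u)))
             - exp (pi * \<i> * u) * theta_half \<tau> (exp (2 * pi * \<i> * u))) holomorphic_on UNIV"
    by (intro holomorphic_intros *)
  thus ?thesis
    using theta1_eq[OF assms] by (metis (no_types, lifting) ext holomorphic_on_subset subset_UNIV)
qed

lemma theta1_minus:
  assumes "Im \<tau> > 0"
  shows   "theta1 \<tau> (- u) = - theta1 \<tau> u"
  by (simp add: theta1_eq[OF assms])

lemma theta1_add_1:
  assumes "Im \<tau> > 0"
  shows   "theta1 \<tau> (u + 1) = - theta1 \<tau> u"
proof -
  have "exp (pi * \<i> * (u + 1)) = - exp (pi * \<i> * u)"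
       "exp (- (pi * \<i> * (u + 1))) = - exp (- (pi * \<i> * u))"
       "exp (2 * pi * \<i> * (u + 1)) = exp (2 * pi * \<i> * u)"
       "exp (- (2 * pi * \<i> * (u + 1))) = exp (- (2 * pi * \<i> * u))"
    by (simp_all add: ring_distribs exp_add exp_diff exp_minus)
  thus ?thesis by (simp add: theta1_eq[OF assms])
qed

text \<open>Completing the square: the term of index \<open>m\<close> at \<open>u + \<tau>\<close>
  is a fixed factor times the term of index \<open>m + 1\<close> at \<open>u\<close>.\<close>

lemma theta1_add_tau:
  "theta1 \<tau> (u + \<tau>) = - exp (- (pi * \<i> * \<tau>) - 2 * pi * \<i> * u) * theta1 \<tau> u"
proof -
  define T where "T = (\<lambda>u (m::int). exp (pi * \<i> * (of_int m + 1/2)^2 * \<tau>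
                      + 2 * pi * \<i> * (of_int m + 1/2) * (u + 1/2)))"
  have "T (u + \<tau>) m = (- exp (- (pi * \<i> * \<tau>) - 2 * pi * \<i> * u)) * T u (m + 1)" for m
  proof -
    have "T (u + \<tau>) m = exp (- (pi * \<i> * \<tau>) - 2 * pi * \<i> * u) * T u (m + 1) * exp (-(pi * \<i>))"
      unfolding T_def exp_add [symmetric]
      by (rule arg_cong[of _ _ exp]) (simp add: field_simps power2_eq_square)
    thus ?thesis by (simp add: exp_minus)
  qed
  hence "infsum (T (u + \<tau>)) UNIV =
           infsum (\<lambda>m. (- exp (- (pi * \<i> * \<tau>) - 2 * pi * \<i> * u)) * T u (m + 1)) UNIV"
    by (intro infsum_cong)
  also have "\<dots> = - exp (- (pi * \<i> * \<tau>) - 2 * pi * \<i> * u) * infsum (\<lambda>m. T u (m + 1)) UNIV"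
    by (rule infsum_cmult_right')
  also have "infsum (\<lambda>m. T u (m + 1)) UNIV = infsum (T u) UNIV"
    by (rule infsum_reindex_bij_betw) (auto intro!: bij_betwI[of _ _ _ "\<lambda>m. m - 1"])
  finally show ?thesis unfolding theta1_def T_def by simp
qed

lemma theta1_not_identically_zero:
  assumes "Im \<tau> > 0"
  obtains u where "theta1 \<tau> u \<noteq> 0"
proof -
  have "\<not> (\<forall>u. theta1 \<tau> u = 0)"
  proof
    assume *: "\<forall>u. theta1 \<tau> u = 0"
    \<comment> \<open>Then the entire function \<open>z * theta_half \<tau> z\<close> has a limit at infinity, so it is constant.\<close>
    have eq: "z * theta_half \<tau> z = theta_half \<tau> (inverse z)" if "z \<noteq> 0" for z
    proof -
      define u where "u = ln z / (2 * pi * \<i>)"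
      have z: "exp (2 * pi * \<i> * u) = z" using that by (simp add: u_def)
      have "exp (- (pi * \<i> * u)) * theta_half \<tau> (inverse z) = exp (pi * \<i> * u) * theta_half \<tau> z"
        using * theta1_eq[OF assms, of u] z by (simp add: exp_minus)
      hence "theta_half \<tau> (inverse z) = exp (pi * \<i> * u) * exp (pi * \<i> * u) * theta_half \<tau> z"
        by (simp add: exp_minus field_simps)
      also have "exp (pi * \<i> * u) * exp (pi * \<i> * u) = z"
        unfolding exp_add [symmetric] using z by (simp add: algebra_simps)
      finally show ?thesis ..
    qed
    have "isCont (theta_half \<tau>) 0"
      using theta_half_holomorphic[OF assms]
      by (meson UNIV_I holomorphic_on_imp_continuous_on open_UNIV continuous_on_eq_continuous_at)
    hence "((\<lambda>z. theta_half \<tau> (inverse z)) \<longlongrightarrow> theta_half \<tau> 0) at_infinity"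
      using tendsto_compose tendsto_inverse_0 unfolding isCont_def by fast
    hence "((\<lambda>z. z * theta_half \<tau> z) \<longlongrightarrow> theta_half \<tau> 0) at_infinity"
      by (rule Lim_transform_eventually)
         (use eq eventually_not_equal_at_infinity[of 0] in \<open>auto elim!: eventually_mono\<close>)
    \<comment> \<open>The constant is read off at \<open>z = 0\<close>; it would force the constant
      coefficient of \<open>theta_half\<close>, an exponential, to be zero.\<close>
    hence "0 * theta_half \<tau> 0 = theta_half \<tau> 0"
      by (intro Liouville_weak[where f = "\<lambda>z. z * theta_half \<tau> z"])
         (intro holomorphic_intros theta_half_holomorphic assms)
    thus False by (simp add: theta_half_def eval_fps_at_0 theta_coeff_def)
  qed
  thus ?thesis using that by blast
qed


section \<open>Zeros of the theta function\<close>

text \<open>Only the fractional part \<open>r\<close> of the shift matters. The interval from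
  \<open>r\<close> to \<open>1 + r\<close> is cut at 1, and the second piece is moved back by one
  period.\<close>

lemma integral_periodic_shift:
  fixes f :: "real \<Rightarrow> 'a::banach"
  assumes cont: "continuous_on UNIV f" and per: "\<And>x. f (x + 1) = f x"
  shows   "integral {0..1} (\<lambda>x. f (x + s)) = integral {0..1} f"
proof -
  have per_nat: "f (x + real n) = f x" for x n
  proof (induction n)
    case (Suc n)
    have "f (x + real (Suc n)) = f (x + real n + 1)" by (simp add: algebra_simps)
    thus ?case using per Suc by simp
  qed auto
  have per_int: "f (x + of_int k) = f x" for x k
  proof (cases "k \<ge> 0")
    case True
    thus ?thesis using per_nat[of x "nat k"] by simp
  next
    case False
    thus ?thesis using per_nat[of "x + of_int k" "nat (-k)"] by simp
  qed
  define r where "r = frac s"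
  have r: "0 \<le> r" "r < 1" by (auto simp: r_def frac_lt_1)
  have int: "f integrable_on {a..b}" for a b
    by (rule integrable_continuous_real) (rule continuous_on_subset[OF cont], simp)
  have shift: "integral {a..b} (\<lambda>x. f (x + c)) = integral {a + c..b + c} f" for a b c
    using has_integral_shift_Icc_real[of f c "integral {a + c..b + c} f" a b]
          integrable_integral[OF int[of "a + c" "b + c"]]
    by (intro integral_unique) (simp add: o_def add.commute)
  have "f (x + s) = f (x + r)" for x
    using per_int[of "x + r" "\<lfloor>s\<rfloor>"] by (simp add: r_def frac_def)
  hence "integral {0..1} (\<lambda>x. f (x + s)) = integral {0..1} (\<lambda>x. f (x + r))" by simp
  also have "\<dots> = integral {r..1 + r} f" using shift[of 0 1 r] by simp
  also have "\<dots> = integral {r..1} f + integral {1..1 + r} f"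
    using r by (intro Henstock_Kurzweil_Integration.integral_combine [symmetric] int) auto
  also have "integral {1..1 + r} f = integral {0..r} f"
    using shift[of 0 r 1] per by (simp add: add.commute)
  also have "integral {r..1} f + integral {0..r} f = integral {0..1} f"
    using r by (subst add.commute, intro Henstock_Kurzweil_Integration.integral_combine int) auto
  finally show ?thesis .
qed

context
  fixes \<tau> :: complex
  assumes Im_tau: "Im \<tau> > 0"
begin

lemma theta1_has_field_derivative:
  "(theta1 \<tau> has_field_derivative deriv (theta1 \<tau>) u) (at u)"
  using theta1_holomorphic[OF Im_tau, of UNIV] by (simp add: holomorphic_derivI)

lemma theta1_0: "theta1 \<tau> 0 = 0"
  using theta1_minus[OF Im_tau, of 0] by simp

lemma theta1_add_1_eq_0_iff: "theta1 \<tau> (u + 1) = 0 \<longleftrightarrow> theta1 \<tau> u = 0"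
  by (simp add: theta1_add_1[OF Im_tau])

lemma theta1_add_tau_eq_0_iff: "theta1 \<tau> (u + \<tau>) = 0 \<longleftrightarrow> theta1 \<tau> u = 0"
  by (simp add: theta1_add_tau)

section \<open>Periods of the logarithmic derivative and its integral around a period box\<close>

lemma rho_add_1: "rho \<tau> (u + 1) = rho \<tau> u"
proof -
  have "((\<lambda>u. theta1 \<tau> (u + 1)) has_field_derivative deriv (theta1 \<tau>) (u + 1)) (at u)"
    using theta1_has_field_derivative[of "u + 1"] by (simp add: DERIV_shift)
  moreover have "((\<lambda>u. theta1 \<tau> (u + 1)) has_field_derivative - deriv (theta1 \<tau>) u) (at u)"
    unfolding theta1_add_1[OF Im_tau] by (intro derivative_intros theta1_has_field_derivative)
  ultimately have "deriv (theta1 \<tau>) (u + 1) = - deriv (theta1 \<tau>) u"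
    by (rule DERIV_unique)
  thus ?thesis by (simp add: rho_def theta1_add_1[OF Im_tau])
qed

text \<open>The logarithmic derivative of the exponential factor contributes
  \<open>- 2 * pi * \<i>\<close>. At a zero of theta both values of \<open>rho\<close> are 0 by the
  convention on division, so such points are excluded.\<close>

lemma rho_add_tau:
  assumes "theta1 \<tau> u \<noteq> 0"
  shows   "rho \<tau> (u + \<tau>) = rho \<tau> u - 2 * pi * \<i>"
proof -
  define e where "e = (\<lambda>u. - exp (- (pi * \<i> * \<tau>) - 2 * pi * \<i> * u))"
  have "((\<lambda>u. theta1 \<tau> (u + \<tau>)) has_field_derivative deriv (theta1 \<tau>) (u + \<tau>)) (at u)"
    using theta1_has_field_derivative[of "u + \<tau>"] by (simp add: DERIV_shift)
  moreover have "((\<lambda>u. e u * theta1 \<tau> u) has_field_derivative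
          (e u * deriv (theta1 \<tau>) u - 2 * pi * \<i> * e u * theta1 \<tau> u)) (at u)"
    unfolding e_def by (auto intro!: derivative_eq_intros theta1_has_field_derivative)
  moreover have eq: "theta1 \<tau> (u + \<tau>) = e u * theta1 \<tau> u" for u
    by (simp add: theta1_add_tau e_def)
  ultimately have "deriv (theta1 \<tau>) (u + \<tau>) = e u * deriv (theta1 \<tau>) u - 2 * pi * \<i> * e u * theta1 \<tau> u"
    unfolding eq using DERIV_unique by blast
  moreover have "e u \<noteq> 0" by (simp add: e_def)
  ultimately show ?thesis using assms unfolding rho_def eq by (simp add: diff_divide_distrib)
qed

lemma rho_holomorphic:
  assumes "\<And>u. u \<in> A \<Longrightarrow> theta1 \<tau> u \<noteq> 0" "open A"
  shows   "rho \<tau> holomorphic_on A"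
  unfolding rho_def using assms
  by (intro holomorphic_intros theta1_holomorphic Im_tau holomorphic_deriv)

lemma continuous_on_rho:
  assumes "\<And>u. u \<in> A \<Longrightarrow> theta1 \<tau> u \<noteq> 0"
  shows   "continuous_on A (rho \<tau>)"
proof -
  have "theta1 \<tau> holomorphic_on UNIV" by (rule theta1_holomorphic[OF Im_tau])
  moreover from this have "deriv (theta1 \<tau>) holomorphic_on UNIV" by (rule holomorphic_deriv) simp
  ultimately have "continuous_on A (theta1 \<tau>)" "continuous_on A (deriv (theta1 \<tau>))"
    using holomorphic_on_imp_continuous_on continuous_on_subset by blast+
  thus ?thesis unfolding rho_def using assms by (intro continuous_intros) auto
qed

text \<open>The vertical sides differ by the period 1 and cancel. The lower side minus the upper
  side, both run rightwards, leaves the drop of \<open>rho\<close> under a translation by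
  \<open>\<tau>\<close>.\<close>

lemma contour_integral_rho_period:
  assumes re: "\<And>z. Re z = Re p \<Longrightarrow> theta1 \<tau> z \<noteq> 0"
  assumes im: "\<And>z. Im z = Im p \<Longrightarrow> theta1 \<tau> z \<noteq> 0"
  shows   "contour_integral (rectpath p (p + Complex 1 (Im \<tau>))) (rho \<tau>) = 2 * pi * \<i>"
proof -
  define a2 a3 a4 where "a2 = p + 1" and "a3 = p + Complex 1 (Im \<tau>)" and "a4 = p + \<i> * Im \<tau>"
  have re': "theta1 \<tau> z \<noteq> 0" if "Re z = Re p + 1" for z
    using re[of "z - 1"] theta1_add_1_eq_0_iff[of "z - 1"] that by simp
  have im': "theta1 \<tau> z \<noteq> 0" if "Im z = Im p + Im \<tau>" for z
    using im[of "z - \<tau>"] theta1_add_tau_eq_0_iff[of "z - \<tau>"] that by simp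
  have cont: "continuous_on (closed_segment p a2) (rho \<tau>)"
       "continuous_on (closed_segment a2 a3) (rho \<tau>)"
       "continuous_on (closed_segment a3 a4) (rho \<tau>)"
       "continuous_on (closed_segment a4 p) (rho \<tau>)"
    by (rule continuous_on_rho, use re re' im im' in
          \<open>auto simp: a2_def a3_def a4_def closed_segment_same_Re closed_segment_same_Im\<close>)+
  note int = cont[THEN contour_integrable_continuous_linepath]
  have "contour_integral (rectpath p a3) (rho \<tau>) =
          contour_integral (linepath p a2) (rho \<tau>) + (contour_integral (linepath a2 a3) (rho \<tau>) +
          (contour_integral (linepath a3 a4) (rho \<tau>) + contour_integral (linepath a4 p) (rho \<tau>)))"
  proof -
    have "a2 = Complex (Re a3) (Im p)" "a4 = Complex (Re p) (Im a3)"
      by (auto simp: complex_eq_iff a2_def a3_def a4_def)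
    thus ?thesis
      unfolding rectpath_def Let_def using int by (simp add: contour_integrable_joinI)
  qed
  also have "contour_integral (linepath a3 a4) (rho \<tau>) = - contour_integral (linepath a4 a3) (rho \<tau>)"
    by (rule contour_integral_reverse_linepath[OF cont(3)])
  also have "contour_integral (linepath a4 p) (rho \<tau>) = - contour_integral (linepath p a4) (rho \<tau>)"
    by (rule contour_integral_reverse_linepath[OF cont(4)])
  also have "contour_integral (linepath a2 a3) (rho \<tau>) = contour_integral (linepath p a4) (rho \<tau>)"
  proof -
    have "a3 - a2 = a4 - p" by (simp add: a2_def a3_def a4_def complex_eq_iff)
    moreover have "linepath a2 a3 x = linepath p a4 x + 1" for x
      by (simp add: linepath_def a2_def a3_def a4_def complex_eq_iff algebra_simps)
    ultimately show ?thesis unfolding contour_integral_integral by (simp add: rho_add_1)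
  qed
  also have "contour_integral (linepath a4 a3) (rho \<tau>) =
               contour_integral (linepath p a2) (rho \<tau>) - 2 * pi * \<i>"
  proof -
    define f where "f = (\<lambda>x. rho \<tau> (a4 + of_real x))"
    have "contour_integral (linepath a4 a3) (rho \<tau>) = integral {0..1} f"
    proof -
      have "a3 - a4 = 1" by (simp add: a3_def a4_def complex_eq_iff)
      moreover have "linepath a4 a3 x = a4 + of_real x" for x
        by (simp add: linepath_def a3_def a4_def complex_eq_iff algebra_simps)
      ultimately show ?thesis unfolding contour_integral_integral f_def by simp
    qed
    also have "\<dots> = integral {0..1} (\<lambda>x. f (x + Re \<tau>))"
    proof (rule integral_periodic_shift [symmetric])
      have "continuous_on {z. Im z = Im a4} (rho \<tau>)"
        by (rule continuous_on_rho) (use im' in \<open>auto simp: a4_def\<close>)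
      thus "continuous_on UNIV f"
        unfolding f_def by (rule continuous_on_compose2) (auto intro!: continuous_intros)
      show "f (x + 1) = f x" for x
        unfolding f_def using rho_add_1[of "a4 + of_real x"] by (simp add: add_ac)
    qed
    also have "\<dots> = integral {0..1} (\<lambda>x. rho \<tau> (p + of_real x) - 2 * pi * \<i>)"
    proof (intro integral_cong)
      fix x :: real
      \<comment> \<open>Sliding along the upper side by \<open>Re \<tau>\<close> makes it the
        translate of the lower side by \<open>\<tau>\<close>.\<close>
      have "a4 + of_real (x + Re \<tau>) = p + of_real x + \<tau>"
        by (simp add: a4_def complex_eq_iff)
      thus "f (x + Re \<tau>) = rho \<tau> (p + of_real x) - 2 * pi * \<i>"
        unfolding f_def using rho_add_tau[of "p + of_real x"] im by (simp del: of_real_add)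
    qed
    also have "\<dots> = integral {0..1} (\<lambda>x. rho \<tau> (p + of_real x)) - integral {0..1} (\<lambda>x::real. 2 * pi * \<i>)"
    proof (rule integral_diff)
      have "continuous_on {z. Im z = Im p} (rho \<tau>)"
        by (rule continuous_on_rho) (use im in auto)
      hence "continuous_on {0..1} (\<lambda>x. rho \<tau> (p + of_real x))"
        by (rule continuous_on_compose2) (auto intro!: continuous_intros)
      thus "(\<lambda>x. rho \<tau> (p + of_real x)) integrable_on {0..1}"
        by (rule integrable_continuous_real)
    qed auto
    also have "integral {0..1} (\<lambda>x. rho \<tau> (p + of_real x)) = contour_integral (linepath p a2) (rho \<tau>)"
    proof -
      have "linepath p a2 x = p + of_real x" for x
        by (simp add: linepath_def a2_def complex_eq_iff algebra_simps)
      thus ?thesis unfolding contour_integral_integral by (simp add: a2_def)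
    qed
    finally show ?thesis by simp
  qed
  finally show ?thesis by (simp add: a3_def)
qed

section \<open>Number, order and position of the zeros\<close>

lemma theta1_not_constant: "\<not> theta1 \<tau> constant_on UNIV"
proof
  assume "theta1 \<tau> constant_on UNIV"
  then obtain c where "\<And>u. theta1 \<tau> u = c" by (auto simp: constant_on_def)
  moreover obtain u where "theta1 \<tau> u \<noteq> 0" using theta1_not_identically_zero[OF Im_tau] .
  ultimately show False using theta1_0 by metis
qed

lemma countable_theta1_zeros: "countable {z. theta1 \<tau> z = 0}"
  using holomorphic_countable_zeros[OF theta1_holomorphic[OF Im_tau], of UNIV] theta1_not_constant
  by (simp add: connected_UNIV)

lemma zorder_theta1_pos: "theta1 \<tau> z = 0 \<Longrightarrow> zorder (theta1 \<tau>) z > 0"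
proof -
  assume "theta1 \<tau> z = 0"
  moreover obtain w where "theta1 \<tau> w \<noteq> 0" using theta1_not_identically_zero[OF Im_tau] .
  ultimately show ?thesis
    using zorder_exist_zero[OF theta1_holomorphic[OF Im_tau], of UNIV z] by auto
qed

text \<open>By the argument principle the integral of \<open>rho\<close> counts zeros with
  multiplicity, and it equals \<open>2 * pi * \<i>\<close>.\<close>

lemma theta1_zeros_in_period_box:
  assumes re: "\<And>z. Re z = Re p \<Longrightarrow> theta1 \<tau> z \<noteq> 0"
  assumes im: "\<And>z. Im z = Im p \<Longrightarrow> theta1 \<tau> z \<noteq> 0"
  defines "B \<equiv> {z \<in> box p (p + Complex 1 (Im \<tau>)). theta1 \<tau> z = 0}"
  shows   "finite B" "(\<Sum>z\<in>B. zorder (theta1 \<tau>) z) = 1"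
proof -
  define q where "q = p + Complex 1 (Im \<tau>)"
  define g where "g = rectpath p q"
  have le: "Re p \<le> Re q" "Im p \<le> Im q" using Im_tau by (auto simp: q_def)
  obtain R where R: "cbox p q \<subseteq> ball 0 R"
    using bounded_cbox bounded_subset_ballD by blast
  \<comment> \<open>The shape follows the argument principle: the empty set is the set of poles, and
    the factor 1 in the integral below is the weight function.\<close>
  define pz where "pz = {w \<in> ball 0 R. theta1 \<tau> w = 0 \<or> w \<in> {}}"
  have fin: "finite pz"
  proof (rule finite_subset)
    show "pz \<subseteq> {z \<in> cball 0 R. theta1 \<tau> z = 0}" by (auto simp: pz_def)
    show "finite {z \<in> cball 0 R. theta1 \<tau> z = 0}"
      by (rule holomorphic_compact_finite_zeros[OF theta1_holomorphic[OF Im_tau], of UNIV])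
         (use theta1_not_constant in auto)
  qed
  have B_sub: "B \<subseteq> pz" using R box_subset_cbox[of p q] by (auto simp: B_def pz_def q_def)
  thus "finite B" using fin finite_subset by blast
  have off: "theta1 \<tau> z \<noteq> 0" if "z \<in> path_image g" for z
  proof -
    \<comment> \<open>The right and upper sides are brought back to the zero-free lines through
      \<open>p\<close> by subtracting 1 and \<open>\<tau>\<close>.\<close>
    have "Re z = Re p \<or> Re (z - 1) = Re p \<or> Im z = Im p \<or> Im (z - \<tau>) = Im p"
      using that le by (auto simp: g_def path_image_rectpath q_def)
    thus ?thesis
      using re im theta1_add_1_eq_0_iff[of "z - 1"] theta1_add_tau_eq_0_iff[of "z - \<tau>"]
      by (metis diff_add_cancel)
  qed
  have img: "path_image g \<subseteq> cbox p q"
    using le unfolding g_def by (rule path_image_rectpath_subset_cbox)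
  have "contour_integral g (\<lambda>x. deriv (theta1 \<tau>) x * 1 / theta1 \<tau> x) =
          2 * pi * \<i> * (\<Sum>w\<in>pz. winding_number g w * 1 * zorder (theta1 \<tau>) w)"
    unfolding pz_def
  proof (rule argument_principle)
    show "theta1 \<tau> holomorphic_on ball 0 R - {}" by (rule theta1_holomorphic[OF Im_tau])
    show "path_image g \<subseteq> ball 0 R - {w \<in> ball 0 R. theta1 \<tau> w = 0 \<or> w \<in> {}}"
      using img R off by blast
    show "\<forall>z. z \<notin> ball 0 R \<longrightarrow> winding_number g z = 0"
      using R le unfolding g_def by (intro allI impI winding_number_rectpath_outside) auto
    show "finite {w \<in> ball 0 R. theta1 \<tau> w = 0 \<or> w \<in> {}}" using fin by (simp add: pz_def)
  qed (auto simp: g_def)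
  moreover have "contour_integral g (\<lambda>x. deriv (theta1 \<tau>) x * 1 / theta1 \<tau> x) = 2 * pi * \<i>"
    using contour_integral_rho_period[of p] re im by (simp add: g_def q_def rho_def[abs_def])
  ultimately have "(\<Sum>w\<in>pz. winding_number g w * zorder (theta1 \<tau>) w) = 1" by simp
  also have "(\<Sum>w\<in>pz. winding_number g w * zorder (theta1 \<tau>) w) =
               (\<Sum>w\<in>B. of_int (zorder (theta1 \<tau>) w))"
  proof (rule sum.mono_neutral_cong_right[OF fin B_sub])
    \<comment> \<open>The ball may contain further zeros, but those lie outside the closed rectangle
      and have winding number 0.\<close>
    show "\<forall>w\<in>pz - B. winding_number g w * zorder (theta1 \<tau>) w = 0"
    proof
      fix w assume w: "w \<in> pz - B"
      hence "w \<notin> path_image g" "theta1 \<tau> w = 0" using off by (auto simp: pz_def)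
      hence "w \<notin> cbox p q"
        using w path_image_rectpath_cbox_minus_box[OF le] by (auto simp: g_def B_def q_def)
      thus "winding_number g w * zorder (theta1 \<tau>) w = 0"
        using le unfolding g_def by (simp add: winding_number_rectpath_outside)
    qed
    show "winding_number g w * zorder (theta1 \<tau>) w = of_int (zorder (theta1 \<tau>) w)" if "w \<in> B" for w
      using that winding_number_rectpath[of w p q] by (simp add: g_def B_def q_def)
  qed
  finally have "of_int (\<Sum>w\<in>B. zorder (theta1 \<tau>) w) = (of_int 1 :: complex)" by simp
  thus "(\<Sum>w\<in>B. zorder (theta1 \<tau>) w) = 1" unfolding of_int_eq_iff .
qed

lemma theta1_add_lattice_eq_0_iff:
  "theta1 \<tau> (u + of_int a + of_int b * \<tau>) = 0 \<longleftrightarrow> theta1 \<tau> u = 0"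
proof -
  have 1: "theta1 \<tau> (u + of_int a) = 0 \<longleftrightarrow> theta1 \<tau> u = 0" for u
  proof (induction a rule: int_induct[of _ 0])
    case (step1 i)
    thus ?case using theta1_add_1_eq_0_iff[of "u + of_int i"] by (simp add: add_ac)
  next
    case (step2 i)
    thus ?case using theta1_add_1_eq_0_iff[of "u + of_int i - 1"] by (simp add: algebra_simps)
  qed auto
  have 2: "theta1 \<tau> (u + of_int b * \<tau>) = 0 \<longleftrightarrow> theta1 \<tau> u = 0" for u
  proof (induction b rule: int_induct[of _ 0])
    case (step1 i)
    thus ?case using theta1_add_tau_eq_0_iff[of "u + of_int i * \<tau>"] by (simp add: algebra_simps)
  next
    case (step2 i)
    thus ?case using theta1_add_tau_eq_0_iff[of "u + of_int i * \<tau> - \<tau>"] by (simp add: algebra_simps)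
  qed auto
  show ?thesis using 1 2 by simp
qed

text \<open>The zeros are countable, so their real and imaginary parts cannot fill an interval. The
  intervals are chosen so that 0 falls inside the box.\<close>

lemma theta1_period_box_exists:
  obtains p where "\<And>z. Re z = Re p \<Longrightarrow> theta1 \<tau> z \<noteq> 0" "\<And>z. Im z = Im p \<Longrightarrow> theta1 \<tau> z \<noteq> 0"
                  "0 \<in> box p (p + Complex 1 (Im \<tau>))"
proof -
  let ?Z = "{z. theta1 \<tau> z = 0}"
  have cnt: "countable (h ` ?Z)" for h :: "complex \<Rightarrow> real"
    using countable_theta1_zeros by (rule countable_image)
  have "uncountable {-1<..<0::real}" "uncountable {- Im \<tau><..<0}"
    using Im_tau by (simp_all add: uncountable_open_interval)
  hence "\<not> {-1<..<0} \<subseteq> Re ` ?Z" "\<not> {- Im \<tau><..<0} \<subseteq> Im ` ?Z"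
    using countable_subset[OF _ cnt] by blast+
  then obtain x y where xy: "x \<in> {-1<..<0}" "x \<notin> Re ` ?Z" "y \<in> {- Im \<tau><..<0}" "y \<notin> Im ` ?Z"
    by blast
  show ?thesis
    by (rule that[of "Complex x y"]) (use xy in \<open>auto simp: in_box_complex_iff\<close>)
qed

text \<open>The orders of the zeros in the box add up to 1 and each is at least 1. Hence the known
  zero 0 is the only one there, and it is simple; every other zero is a lattice translate of a zero
  in the box.\<close>

lemma
  shows theta1_zero_imp_lattice: "theta1 \<tau> u = 0 \<Longrightarrow> u \<in> lattice \<tau>"
    and deriv_theta1_0_nonzero: "deriv (theta1 \<tau>) 0 \<noteq> 0"
proof -
  obtain p where p: "\<And>z. Re z = Re p \<Longrightarrow> theta1 \<tau> z \<noteq> 0" "\<And>z. Im z = Im p \<Longrightarrow> theta1 \<tau> z \<noteq> 0"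
                    "0 \<in> box p (p + Complex 1 (Im \<tau>))"
    using theta1_period_box_exists by metis
  define B where "B = {z \<in> box p (p + Complex 1 (Im \<tau>)). theta1 \<tau> z = 0}"
  have B: "finite B" "(\<Sum>z\<in>B. zorder (theta1 \<tau>) z) = 1"
    unfolding B_def by (rule theta1_zeros_in_period_box; use p in blast)+
  have "0 \<in> B" using p(3) theta1_0 by (auto simp: B_def)
  have pos: "zorder (theta1 \<tau>) z \<ge> 1" if "z \<in> B" for z
    using zorder_theta1_pos[of z] that by (auto simp: B_def)
  have sum: "(\<Sum>z\<in>B. zorder (theta1 \<tau>) z) = zorder (theta1 \<tau>) 0 + (\<Sum>z\<in>B-{0}. zorder (theta1 \<tau>) z)"
    by (rule sum.remove[OF B(1) \<open>0 \<in> B\<close>])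
  have ge: "(\<Sum>z\<in>B-{0}. zorder (theta1 \<tau>) z) \<ge> (\<Sum>z\<in>B-{0}. 1)"
    by (rule sum_mono) (use pos in auto)
  with sum B(2) pos[OF \<open>0 \<in> B\<close>] have "card (B - {0}) = 0" and z1: "zorder (theta1 \<tau>) 0 = 1"
    by auto
  hence "B - {0} = {}" using B(1) by (metis card_0_eq finite_Diff)
  hence B_eq: "B = {0}" using \<open>0 \<in> B\<close> by blast
  show "deriv (theta1 \<tau>) 0 \<noteq> 0"
  proof
    assume *: "deriv (theta1 \<tau>) 0 = 0"
    obtain w where "theta1 \<tau> w \<noteq> 0" using theta1_not_identically_zero[OF Im_tau] .
    \<comment> \<open>A vanishing derivative would make 0 a zero of order at least two.\<close>
    have "zorder (theta1 \<tau>) 0 \<ge> int 2"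
    proof (rule zorder_geI)
      show "theta1 \<tau> holomorphic_on UNIV" by (rule theta1_holomorphic[OF Im_tau])
      thus "theta1 \<tau> analytic_on {0}" using analytic_at by blast
      show "(deriv ^^ k) (theta1 \<tau>) 0 = 0" if "k < 2" for k
        using that * theta1_0 by (auto simp: less_2_cases_iff)
    qed (use \<open>theta1 \<tau> w \<noteq> 0\<close> in auto)
    with z1 show False by simp
  qed
  show "u \<in> lattice \<tau>" if "theta1 \<tau> u = 0"
  proof -
    \<comment> \<open>The multiple of \<open>\<tau>\<close> is removed first, since it also changes
      the real part. The floors give a half-open box; its closed edges carry no zeros, so
      \<open>v\<close> lies in the open box.\<close>
    define b where "b = \<lfloor>(Im u - Im p) / Im \<tau>\<rfloor>"
    define a where "a = \<lfloor>Re u - of_int b * Re \<tau> - Re p\<rfloor>"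
    define v where "v = u + of_int (-a) + of_int (-b) * \<tau>"
    have v0: "theta1 \<tau> v = 0" unfolding v_def theta1_add_lattice_eq_0_iff by fact
    have "of_int b * Im \<tau> \<le> Im u - Im p" "Im u - Im p < (of_int b + 1) * Im \<tau>"
      using floor_divide_lower[OF Im_tau] floor_divide_upper[OF Im_tau] unfolding b_def by blast+
    moreover have "of_int a \<le> Re u - of_int b * Re \<tau> - Re p" "Re u - of_int b * Re \<tau> - Re p < of_int a + 1"
      unfolding a_def by linarith+
    moreover have "Re v \<noteq> Re p" "Im v \<noteq> Im p" using p(1,2) v0 by blast+
    ultimately have "v \<in> B" using v0
      by (simp add: B_def in_box_complex_iff v_def algebra_simps)
    hence "u = of_int a + of_int b * \<tau>" using B_eq by (simp add: v_def algebra_simps)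
    thus ?thesis unfolding lattice_def by blast
  qed
qed

end


section \<open>Meromorphic solutions at a regular singular point\<close>

text \<open>A Cauchy product with arbitrary lower bounds in place of the subdegrees, which need not
  be known; it covers zero factors as well.\<close>

lemma fls_times_nth_below:
  fixes F G :: "'a::comm_ring_1 fls"
  assumes F: "\<And>m. m < a \<Longrightarrow> F $$ m = 0" and G: "\<And>m. m < b \<Longrightarrow> G $$ m = 0"
  shows   "(F * G) $$ n = (\<Sum>m=a..n-b. F $$ m * G $$ (n - m))"
proof (cases "F = 0 \<or> G = 0")
  case False
  hence le: "a \<le> fls_subdegree F" "b \<le> fls_subdegree G"
    using F G by (auto intro!: fls_subdegree_geI)
  have "(F * G) $$ n = (\<Sum>m=fls_subdegree F..n - fls_subdegree G. F $$ m * G $$ (n - m))"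
    by (rule fls_times_nth(2))
  also have "\<dots> = (\<Sum>m=a..n-b. F $$ m * G $$ (n - m))"
    by (rule sum.mono_neutral_left) (use le in auto)
  finally show ?thesis .
qed auto

text \<open>In the equation for exponent \<open>k\<close> the unknown \<open>F $$ (k + 1)\<close>
  has the factor \<open>k + 1 + c\<close>, where \<open>c\<close> is the polar coefficient of
  \<open>W\<close>. This is nonzero for every integer \<open>k\<close>, so the recursion determines
  \<open>F\<close>.\<close>

lemma fls_linear_ode_nth:
  fixes F W G :: "complex fls"
  assumes ode: "fls_deriv F + W * F = G"
      and W: "\<And>m. m < -1 \<Longrightarrow> W $$ m = 0" and c: "W $$ (-1) \<notin> \<int>"
      and G: "\<And>m. m < -2 \<Longrightarrow> G $$ m = 0"
  shows   "m < -1 \<Longrightarrow> F $$ m = 0"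
      and "F $$ (-1) = G $$ (-2) / (W $$ (-1) - 1)"
      and "F $$ 0 = (G $$ (-1) - W $$ 0 * F $$ (-1)) / W $$ (-1)"
      and "F $$ 1 = (G $$ 0 - W $$ 0 * F $$ 0 - W $$ 1 * F $$ (-1)) / (W $$ (-1) + 1)"
proof -
  define c where "c = W $$ (-1)"
  have nz: "of_int k + c \<noteq> 0" for k
  proof
    assume "of_int k + c = 0"
    hence "c = of_int (-k)" by (simp add: add_eq_0_iff)
    thus False using c unfolding c_def by (metis Ints_of_int)
  qed
  have coeff: "of_int (k + 1) * F $$ (k + 1) + (\<Sum>m=-1..k-d. W $$ m * F $$ (k - m)) = G $$ k"
    if "\<And>m. m < d \<Longrightarrow> F $$ m = 0" for k d
  proof -
    have "G $$ k = fls_deriv F $$ k + (W * F) $$ k" by (simp flip: ode)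
    also have "(W * F) $$ k = (\<Sum>m=-1..k-d. W $$ m * F $$ (k - m))"
      by (rule fls_times_nth_below) (use W that in auto)
    finally show ?thesis by simp
  qed
  have below: "F $$ m = 0" if "m < -1" for m
  proof (cases "F = 0")
    case False
    define d where "d = fls_subdegree F"
    have "d \<ge> -1"
    proof (rule ccontr)
      assume "\<not> d \<ge> -1"
      \<comment> \<open>At exponent \<open>d - 1\<close> only the derivative and the polar term of
        \<open>W\<close> contribute, and \<open>d - 1 < -2\<close> makes the right side
        vanish.\<close>
      hence "(of_int d + c) * F $$ d = 0"
        using coeff[of d "d - 1"] G[of "d - 1"] by (simp add: d_def c_def algebra_simps)
      with nz have "F $$ d = 0" by simp
      with False show False by (simp add: d_def)
    qed
    thus ?thesis using that by (simp add: d_def)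
  qed simp
  show "m < -1 \<Longrightarrow> F $$ m = 0" by (rule below)
  have iv: "{-1..0::int} = {-1, 0}" "{-1..1::int} = {-1, 0, 1}" by auto
  show "F $$ (-1) = G $$ (-2) / (W $$ (-1) - 1)"
    using coeff[of "-1" "-2"] below nz[of "-1"] by (simp add: c_def field_simps)
  show "F $$ 0 = (G $$ (-1) - W $$ 0 * F $$ (-1)) / W $$ (-1)"
    using coeff[of "-1" "-1"] below nz[of 0] by (simp add: c_def field_simps iv)
  show "F $$ 1 = (G $$ 0 - W $$ 0 * F $$ 0 - W $$ 1 * F $$ (-1)) / (W $$ (-1) + 1)"
    using coeff[of "-1" 0] below nz[of 1] by (simp add: c_def field_simps iv)
qed

text \<open>The values \<open>f0\<close>, \<open>f1\<close>, \<open>f2\<close> are the coefficients of \<open>z\<^sup>-\<^sup>1\<close>, \<open>1\<close>, \<open>z\<close> in the solution of \<open>f' + W f = G\<close>.\<close>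
definition residue_pairing :: "complex fls \<Rightarrow> complex fls \<Rightarrow> complex fls \<Rightarrow> complex" where
  "residue_pairing W G K =
     (let c = W $$ (-1);
          f0 = G $$ (-2) / (c - 1);
          f1 = (G $$ (-1) - W $$ 0 * f0) / c;
          f2 = (G $$ 0 - W $$ 0 * f1 - W $$ 1 * f0) / (c + 1)
      in f0 * K $$ 0 + f1 * K $$ (-1) + f2 * K $$ (-2))"

text \<open>A solution without essential singularity has a Laurent series, which solves the formal
  equation and so has forced coefficients. As \<open>K\<close> starts at exponent -2, the residue
  sees only exponents -1, 0 and 1 of it.\<close>

lemma local_solution_residue:
  assumes sol: "local_solution w g f p"
      and w: "(\<lambda>z. w (p + z)) has_laurent_expansion W"
      and g: "(\<lambda>z. g (p + z)) has_laurent_expansion G"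
      and k: "(\<lambda>z. k (p + z)) has_laurent_expansion K"
      and W: "\<And>m. m < -1 \<Longrightarrow> W $$ m = 0" "W $$ (-1) \<notin> \<int>"
      and G: "\<And>m. m < -2 \<Longrightarrow> G $$ m = 0"
      and K: "\<And>m. m < -2 \<Longrightarrow> K $$ m = 0"
  shows   "residue (\<lambda>u. f u * k u) p = residue_pairing W G K"
proof -
  from sol obtain r where r: "r > 0"
    and f': "\<And>u. u \<in> ball p r - {p} \<Longrightarrow> (f has_field_derivative (g u - w u * f u)) (at u)"
    and ess: "not_essential f p"
    unfolding local_solution_def by blast
  have "f holomorphic_on ball p r - {p}"
    by (rule holomorphic_onI) (meson f' field_differentiable_at_within field_differentiable_def)
  hence "isolated_singularity_at f p"
    using r by (intro isolated_singularity_at_holomorphic[of _ "ball p r"]) auto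
  define F where "F = laurent_expansion f p"
  have F: "(\<lambda>z. f (p + z)) has_laurent_expansion F"
    unfolding F_def by (rule not_essential_has_laurent_expansion) fact+
  have "(\<lambda>z. g (p + z) - w (p + z) * f (p + z)) has_laurent_expansion fls_deriv F"
  proof (rule has_laurent_expansion_deriv'[OF F])
    fix z :: complex assume "z \<in> ball 0 r - {0}"
    hence "p + z \<in> ball p r - {p}" by (auto simp: dist_norm)
    from f'[OF this] show "((\<lambda>z. f (p + z)) has_field_derivative
        (g (p + z) - w (p + z) * f (p + z))) (at z)"
      using DERIV_shift[of f _ z p] by (simp add: add.commute)
  qed (use r in auto)
  moreover have "(\<lambda>z. g (p + z) - w (p + z) * f (p + z)) has_laurent_expansion G - W * F"
    by (intro laurent_expansion_intros g w F)
  ultimately have "fls_deriv F = G - W * F" by (rule has_laurent_expansion_unique)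
  hence ode: "fls_deriv F + W * F = G" by simp
  note nth = fls_linear_ode_nth[OF ode W G]
  have "residue (\<lambda>u. f u * k u) p = fls_residue (F * K)"
    by (rule has_laurent_expansion_residue) (intro laurent_expansion_intros F k)
  also have "\<dots> = (\<Sum>m=-1..(-1)-(-2). F $$ m * K $$ (-1 - m))"
    unfolding fls_residue_def by (rule fls_times_nth_below) (use nth(1) K in auto)
  also have "{-1..(-1)-(-2)::int} = {-1, 0, 1}" by auto
  finally show ?thesis
    unfolding residue_pairing_def Let_def by (simp flip: nth(2) nth(3) nth(4))
qed

section \<open>Existence of convergent solutions\<close>

text \<open>From some index on the denominators have modulus at least 1, so the division does not
  enlarge the terms.\<close>

lemma fps_conv_radius_divide_affine:
  fixes E :: "complex fps"
  shows "fps_conv_radius (Abs_fps (\<lambda>k. fps_nth E k / (of_nat k + c))) \<ge> fps_conv_radius E"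
  unfolding fps_conv_radius_def fps_nth_Abs_fps
proof (rule conv_radius_geI_ex')
  fix r :: real assume r: "0 < r" "ereal r < conv_radius (fps_nth E)"
  have "summable (\<lambda>n. norm (fps_nth E n * of_real r ^ n))"
    using r by (intro abs_summable_in_conv_radius) simp
  moreover have "eventually (\<lambda>n. norm (fps_nth E n / (of_nat n + c) * of_real r ^ n) \<le>
                     norm (fps_nth E n * of_real r ^ n)) sequentially"
  proof -
    have "eventually (\<lambda>n. real n \<ge> norm c + 1) sequentially"
      by real_asymp
    thus ?thesis
    proof eventually_elim
      case (elim n)
      have "norm (of_nat n + c) \<ge> real n - norm c"
        using norm_diff_ineq[of "of_nat n :: complex" c] by simp
      with elim have "norm (of_nat n + c) \<ge> 1" by simp
      hence "norm (fps_nth E n) / norm (of_nat n + c) \<le> norm (fps_nth E n) / 1"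
        by (intro divide_left_mono) auto
      hence "norm (fps_nth E n) / norm (of_nat n + c) * r ^ n \<le> norm (fps_nth E n) * r ^ n"
        using r by (intro mult_right_mono) auto
      thus ?case using r by (simp add: norm_mult norm_divide norm_power)
    qed
  qed
  ultimately show "summable (\<lambda>n. fps_nth E n / (of_nat n + c) * of_real r ^ n)"
    by (rule summable_comparison_test_ev[rotated])
qed

lemma has_laurent_expansion_eventually_eq:
  assumes "f has_laurent_expansion F" "g has_laurent_expansion F"
  shows   "eventually (\<lambda>z. f z = g z) (at 0)"
  using assms unfolding has_laurent_expansion_def
  by (auto elim: eventually_elim2)

text \<open>
  The integrating factor \<open>E = exp (\<integral> h)\<close> of the regular part \<open>h\<close> of \<open>w\<close> reduces the equation to
  \<open>z \<phi>' + (c - 1) \<phi> = E g\<^sub>2\<close>, which is solved coefficientwise; non-integrality of \<open>c\<close> keeps the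
  denominators \<open>k + c - 1\<close> from vanishing.
\<close>
lemma local_solution_exists:
  assumes w: "(\<lambda>z. w (p + z)) has_laurent_expansion W"
      and g: "(\<lambda>z. g (p + z)) has_laurent_expansion G"
      and W: "\<And>m. m < -1 \<Longrightarrow> W $$ m = 0" "W $$ (-1) \<notin> \<int>"
      and G: "\<And>m. m < -2 \<Longrightarrow> G $$ m = 0"
  obtains f where "local_solution w g f p"
proof -
  define c where "c = W $$ (-1)"
  have nz: "of_nat k + (c - 1) \<noteq> 0" for k
  proof
    assume "of_nat k + (c - 1) = 0"
    hence "c = of_int (1 - int k)" by (simp add: algebra_simps)
    thus False using W(2) unfolding c_def by (metis Ints_of_int)
  qed
  define h where "h = fls_regpart W"
  \<comment> \<open>\<open>fls_shift (-2)\<close> multiplies by \<open>z^2\<close>; since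
    \<open>g\<close> has a pole of order at most two, \<open>g = g2 / z^2\<close> with
    \<open>g2\<close> regular.\<close>
  define g2 where "g2 = fls_regpart (fls_shift (-2) G)"
  have h_rad: "fps_conv_radius h > 0"
    using w unfolding h_def fps_conv_radius_fls_regpart has_laurent_expansion_def by blast
  have g2_rad: "fps_conv_radius g2 > 0"
    using g unfolding g2_def fps_conv_radius_fls_regpart fls_conv_radius_shift has_laurent_expansion_def
    by blast
  have "(\<lambda>z. c * z powi (-1) + eval_fps h z) has_laurent_expansion
           (fls_const c * fls_X_intpow (-1) + fps_to_fls h)"
    by (intro laurent_expansion_intros has_laurent_expansion_fps eval_fps_has_fps_expansion h_rad)
  also have "fls_const c * fls_X_intpow (-1) + fps_to_fls h = W"
    using W(1) by (intro fls_eqI) (auto simp: c_def h_def not_less eq_neg_iff_add_eq_0 [symmetric])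
  finally have ev_w: "eventually (\<lambda>z. w (p + z) = c / z + eval_fps h z) (at 0)"
    using has_laurent_expansion_eventually_eq[OF w] by (simp add: power_int_minus divide_inverse)
  have "(\<lambda>z. eval_fps g2 z * z powi (-2)) has_laurent_expansion fls_shift 2 (fps_to_fls g2)"
    by (intro laurent_expansion_intros has_laurent_expansion_fps eval_fps_has_fps_expansion g2_rad)
  also have "fls_shift 2 (fps_to_fls g2) = G"
    using G by (intro fls_eqI) (auto simp: g2_def not_less)
  finally have ev_g: "eventually (\<lambda>z. g (p + z) = eval_fps g2 z / z ^ 2) (at 0)"
    using has_laurent_expansion_eventually_eq[OF g] by (simp add: power_int_minus divide_inverse)

  obtain r0 where r0: "r0 > 0" "ereal r0 < min (fps_conv_radius h) (fps_conv_radius g2)"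
    using h_rad g2_rad by (metis ereal_dense2 ereal_less(2) min_less_iff_conj)
  have sub: "ball 0 r0 \<subseteq> eball 0 (fps_conv_radius h)" "ball 0 r0 \<subseteq> eball 0 (fps_conv_radius g2)"
    using r0(2) by (auto intro!: ball_eball_mono[THEN subsetD])
  have "eval_fps h holomorphic_on ball 0 r0" by (intro holomorphic_intros sub)
  then obtain H where H: "\<And>z. z \<in> ball 0 r0 \<Longrightarrow> (H has_field_derivative eval_fps h z) (at z within ball 0 r0)"
    using holomorphic_convex_primitive'[of "ball 0 r0" "eval_fps h"] by auto
  define E where "E = (\<lambda>z. exp (H z))"
  have E': "(E has_field_derivative (eval_fps h z * E z)) (at z)" if "z \<in> ball 0 r0" for z
    using H[OF that] that unfolding E_def
    by (auto simp: at_within_open[of _ "ball 0 r0"] intro!: derivative_eq_intros)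
  have E_holo: "E holomorphic_on ball 0 r0"
    by (rule holomorphic_onI) (meson E' field_differentiable_at_within field_differentiable_def)
  have Eg2: "(\<lambda>z. E z * eval_fps g2 z) holomorphic_on ball 0 r0"
    by (intro holomorphic_intros E_holo sub)
  define e where "e = fps_expansion (\<lambda>z. E z * eval_fps g2 z) 0"
  have e: "(\<lambda>z. E z * eval_fps g2 z) has_fps_expansion e"
    unfolding e_def using r0(1)
    by (intro has_fps_expansion_fps_expansion[OF _ _ Eg2]) auto
  define \<phi> where "\<phi> = Abs_fps (\<lambda>k. fps_nth e k / (of_nat k + (c - 1)))"
  have \<phi>_rad: "fps_conv_radius \<phi> > 0"
    using e fps_conv_radius_divide_affine[of e "c - 1"] unfolding has_fps_expansion_def \<phi>_def
    by (meson less_le_trans)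
  have "fps_X * fps_deriv \<phi> + fps_const (c - 1) * \<phi> = e"
  proof (rule fps_ext)
    fix k
    have "fps_nth (fps_X * fps_deriv \<phi> + fps_const (c - 1) * \<phi>) k =
            (of_nat k + (c - 1)) * fps_nth \<phi> k"
      by (cases k) (simp_all add: algebra_simps)
    thus "fps_nth (fps_X * fps_deriv \<phi> + fps_const (c - 1) * \<phi>) k = fps_nth e k"
      using nz[of k] by (simp add: \<phi>_def)
  qed
  moreover have "(\<lambda>z. z * deriv (eval_fps \<phi>) z + (c - 1) * eval_fps \<phi> z) has_fps_expansion
                   (fps_X * fps_deriv \<phi> + fps_const (c - 1) * \<phi>)"
    by (intro fps_expansion_intros eval_fps_has_fps_expansion \<phi>_rad)
  ultimately have "eventually (\<lambda>z. z * deriv (eval_fps \<phi>) z + (c - 1) * eval_fps \<phi> z =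
                     E z * eval_fps g2 z) (nhds 0)"
    using e unfolding has_fps_expansion_def by (auto elim: eventually_elim2)
  hence ev_\<phi>: "eventually (\<lambda>z. z * deriv (eval_fps \<phi>) z + (c - 1) * eval_fps \<phi> z =
                     E z * eval_fps g2 z) (at 0)"
    by (simp add: eventually_at_filter eventually_mono)
  have "eventually (\<lambda>z. z \<in> eball 0 (fps_conv_radius \<phi>)) (nhds 0)"
       "eventually (\<lambda>z. z \<in> ball 0 r0) (nhds (0::complex))"
    by (rule eventually_nhds_in_open; use \<phi>_rad r0(1) in \<open>simp add: zero_ereal_def\<close>)+
  hence "eventually (\<lambda>z. z \<in> eball 0 (fps_conv_radius \<phi>)) (at 0)"
       "eventually (\<lambda>z. z \<in> ball 0 r0) (at (0::complex))"
    unfolding eventually_at_filter by (auto elim: eventually_mono)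
  with ev_w ev_g ev_\<phi>
  have "eventually (\<lambda>z. w (p + z) = c / z + eval_fps h z \<and> g (p + z) = eval_fps g2 z / z ^ 2 \<and>
          z * deriv (eval_fps \<phi>) z + (c - 1) * eval_fps \<phi> z = E z * eval_fps g2 z \<and>
          z \<in> eball 0 (fps_conv_radius \<phi>) \<and> z \<in> ball 0 r0) (at 0)"
    by eventually_elim auto
  then obtain r where r: "r > 0" and ev: "\<And>z. z \<noteq> 0 \<Longrightarrow> norm z < r \<Longrightarrow>
          w (p + z) = c / z + eval_fps h z \<and> g (p + z) = eval_fps g2 z / z ^ 2 \<and>
          z * deriv (eval_fps \<phi>) z + (c - 1) * eval_fps \<phi> z = E z * eval_fps g2 z \<and>
          z \<in> eball 0 (fps_conv_radius \<phi>) \<and> z \<in> ball 0 r0"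
    unfolding eventually_at by (auto simp: dist_norm)
  \<comment> \<open>The integrating factor of the equation is \<open>z^c * E\<close>. Putting
    \<open>z * E * f = \<phi>\<close> turns \<open>(z^c * E * f)' = z^c * E * g\<close> into
    \<open>z * \<phi>' + (c - 1) * \<phi> = E * g2\<close>, from which the multivalued power has
    disappeared.\<close>
  define f where "f = (\<lambda>z. eval_fps \<phi> z / (z * E z))"
  have E_nz: "E z \<noteq> 0" for z by (simp add: E_def)
  have "local_solution w g (\<lambda>u. f (u - p)) p"
    unfolding local_solution_def
  proof (intro conjI exI ballI)
    show "r > 0" by fact
    fix u assume u: "u \<in> ball p r - {p}"
    define z where "z = u - p"
    have z: "z \<noteq> 0" "norm z < r" using u by (auto simp: z_def dist_norm norm_minus_commute)
    note ev = ev[OF z]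
    have "(eval_fps \<phi> has_field_derivative eval_fps (fps_deriv \<phi>) z) (at z)"
      using ev by (intro has_field_derivative_eval_fps) auto
    hence \<phi>': "(eval_fps \<phi> has_field_derivative deriv (eval_fps \<phi>) z) (at z)"
      by (simp add: DERIV_imp_deriv)
    have dphi: "deriv (eval_fps \<phi>) z = (E z * eval_fps g2 z - (c - 1) * eval_fps \<phi> z) / z"
      using ev z by (simp add: field_simps)
    have zE': "((\<lambda>z. z * E z) has_field_derivative (E z + z * (eval_fps h z * E z))) (at z)"
      using ev by (auto intro!: derivative_eq_intros E')
    have "(f has_field_derivative
            (deriv (eval_fps \<phi>) z * (z * E z) - eval_fps \<phi> z * (E z + z * (eval_fps h z * E z))) /
            ((z * E z) * (z * E z))) (at z)"
      unfolding f_def using z E_nz by (intro DERIV_divide \<phi>' zE') auto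
    also have "(deriv (eval_fps \<phi>) z * (z * E z) - eval_fps \<phi> z * (E z + z * (eval_fps h z * E z))) /
            ((z * E z) * (z * E z)) = eval_fps g2 z / z ^ 2 - (c / z + eval_fps h z) * f z"
      unfolding dphi f_def using z E_nz[of z] by (simp add: field_simps power2_eq_square)
    also have "\<dots> = g u - w u * f (u - p)"
      using ev by (simp add: z_def)
    finally show "((\<lambda>u. f (u - p)) has_field_derivative (g u - w u * f (u - p))) (at u)"
      using DERIV_shift[of f _ u "-p"] by (simp add: z_def)
  next
    have "E has_fps_expansion fps_expansion E 0"
      using r0(1) by (intro has_fps_expansion_fps_expansion[OF _ _ E_holo]) auto
    hence "f has_laurent_expansion (fps_to_fls \<phi> / (fls_X * fps_to_fls (fps_expansion E 0)))"
      unfolding f_def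
      by (intro laurent_expansion_intros has_laurent_expansion_fps eval_fps_has_fps_expansion \<phi>_rad)
    thus "not_essential (\<lambda>u. f (u - p)) p"
      by (intro has_laurent_expansion_not_essential[where F = "fps_to_fls \<phi> / (fls_X * fps_to_fls (fps_expansion E 0))"]) simp
  qed
  thus ?thesis by (rule that)
qed

text \<open>A solution exists and all solutions give the same residue, so the definite description
  in \<open>Ic\<close> denotes this value.\<close>

lemma local_residue_eq:
  assumes w: "(\<lambda>z. w (p + z)) has_laurent_expansion W"
      and g: "(\<lambda>z. g (p + z)) has_laurent_expansion G"
      and k: "(\<lambda>z. k (p + z)) has_laurent_expansion K"
      and W: "\<And>m. m < -1 \<Longrightarrow> W $$ m = 0" "W $$ (-1) \<notin> \<int>"
      and G: "\<And>m. m < -2 \<Longrightarrow> G $$ m = 0"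
      and K: "\<And>m. m < -2 \<Longrightarrow> K $$ m = 0"
  shows   "(THE r. \<exists>f. local_solution w g f p \<and> residue (\<lambda>u. f u * k u) p = r) = residue_pairing W G K"
proof (rule the_equality)
  show "\<exists>f. local_solution w g f p \<and> residue (\<lambda>u. f u * k u) p = residue_pairing W G K"
    using local_solution_exists[OF w g W G] local_solution_residue[OF _ w g k W G K] by metis
qed (use local_solution_residue[OF _ w g k W G K] in blast)


section \<open>Laurent expansions of the logarithmic derivative\<close>

context
  fixes \<tau> :: complex
  assumes Im_tau: "Im \<tau> > 0"
begin

text \<open>The second derivative of an odd function is odd. This removes the constant term of
  \<open>rho\<close> at 0.\<close>

lemma higher_deriv_2_theta1_0: "(deriv ^^ 2) (theta1 \<tau>) 0 = 0"
proof -
  have holo: "theta1 \<tau> holomorphic_on UNIV" by (rule theta1_holomorphic[OF Im_tau])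
  have "(deriv ^^ 2) (\<lambda>w. theta1 \<tau> (-1 * w)) 0 = (-1)^2 * (deriv ^^ 2) (theta1 \<tau>) (-1 * 0)"
    by (rule higher_deriv_compose_linear[OF holo, of UNIV]) auto
  moreover have "(deriv ^^ 2) (\<lambda>w. - theta1 \<tau> w) 0 = - (deriv ^^ 2) (theta1 \<tau>) 0"
    by (rule higher_deriv_uminus[OF holo]) auto
  ultimately show ?thesis by (simp add: theta1_minus[OF Im_tau])
qed

text \<open>The coefficients of \<open>R = T' / T\<close> follow from \<open>R * T = T'\<close>,
  where \<open>T\<close> has a simple zero and no quadratic term.\<close>

lemma rho_laurent_expansion_0:
  defines "R \<equiv> laurent_expansion (rho \<tau>) 0"
  shows   "rho \<tau> has_laurent_expansion R"
    and   "\<And>m. m < -1 \<Longrightarrow> R $$ m = 0" "R $$ (-1) = 1" "R $$ 0 = 0"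
          "R $$ 1 = (deriv ^^ 3) (theta1 \<tau>) 0 / (3 * deriv (theta1 \<tau>) 0)"
proof -
  define T where "T = fps_expansion (theta1 \<tau>) 0"
  have T: "theta1 \<tau> has_fps_expansion T"
    unfolding T_def
    by (rule has_fps_expansion_fps_expansion[of UNIV]) (auto intro: theta1_holomorphic Im_tau)
  have T_nth: "fps_nth T k = (deriv ^^ k) (theta1 \<tau>) 0 / fact k" for k
    by (rule fps_nth_fps_expansion[OF T])
  have T0: "fps_nth T 0 = 0" using theta1_0[OF Im_tau] by (simp add: T_nth)
  have T1: "fps_nth T 1 = deriv (theta1 \<tau>) 0" by (simp add: T_nth)
  have T2: "fps_nth T 2 = 0" using higher_deriv_2_theta1_0 by (simp add: T_nth)
  have T3: "fps_nth T 3 = (deriv ^^ 3) (theta1 \<tau>) 0 / 6" by (simp add: T_nth fact_numeral)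
  have T1_nz: "fps_nth T 1 \<noteq> 0" using deriv_theta1_0_nonzero[OF Im_tau] unfolding T1 .
  have "fps_nth (fps_deriv T) 0 \<noteq> 0" using T1_nz by simp
  hence T_nz: "T \<noteq> 0" "fps_deriv T \<noteq> 0" using T1_nz by (metis fps_zero_nth)+
  have exp: "rho \<tau> has_laurent_expansion (fps_to_fls (fps_deriv T) / fps_to_fls T)"
    unfolding rho_def[abs_def]
    by (intro has_laurent_expansion_divide has_laurent_expansion_fps fps_expansion_intros T)
  hence R: "R = fps_to_fls (fps_deriv T) / fps_to_fls T"
    unfolding R_def by (rule laurent_expansion_0_eqI)
  show "rho \<tau> has_laurent_expansion R" using exp R by simp
  have eq: "R * fps_to_fls T = fps_to_fls (fps_deriv T)" using T_nz by (simp add: R)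
  have "subdegree T = 1" using T0 T1_nz by (intro subdegreeI) auto
  moreover have "subdegree (fps_deriv T) = 0" using T1_nz by (intro subdegreeI) auto
  moreover have "R \<noteq> 0" using eq T_nz by auto
  ultimately have "fls_subdegree R = -1"
    using arg_cong[OF eq, of fls_subdegree] T_nz by (simp add: fls_subdegree_fls_to_fps)
  thus below: "R $$ m = 0" if "m < -1" for m using that by simp
  have nth: "(\<Sum>m=-1..k-1. R $$ m * fps_to_fls T $$ (k - m)) = fps_to_fls (fps_deriv T) $$ k" for k
    unfolding eq [symmetric]
    by (rule fls_times_nth_below [symmetric]) (use below T0 in \<open>auto simp: less_Suc_eq nat_eq_iff\<close>)
  have iv: "{-1..0::int} = {-1, 0}" "{-1..1::int} = {-1, 0, 1}" by auto
  show R1: "R $$ (-1) = 1" using nth[of 0] T1_nz by simp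
  show R0: "R $$ 0 = 0" using nth[of 1] T1_nz T2 R1 by (simp add: iv numeral_2_eq_2)
  \<comment> \<open>The coefficient of \<open>z^2\<close> in \<open>R * T = T'\<close>.\<close>
  have "fps_nth T 3 + R $$ 1 * fps_nth T 1 = 3 * fps_nth T 3"
    using nth[of 2] R0 R1 T2 by (simp add: iv)
  hence "R $$ 1 = 2 * fps_nth T 3 / fps_nth T 1" using T1_nz by (simp add: field_simps)
  thus "R $$ 1 = (deriv ^^ 3) (theta1 \<tau>) 0 / (3 * deriv (theta1 \<tau>) 0)"
    unfolding T1 T3 by simp
qed

text \<open>Here the count of zeros enters: off the lattice theta does not vanish, so
  \<open>rho\<close> is analytic there.\<close>

lemma rho_laurent_expansion_nonlattice:
  assumes "a \<notin> lattice \<tau>"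
  defines "R \<equiv> laurent_expansion (rho \<tau>) a"
  shows   "(\<lambda>z. rho \<tau> (a + z)) has_laurent_expansion R"
    and   "\<And>m. m < 0 \<Longrightarrow> R $$ m = 0" "R $$ 0 = rho \<tau> a" "R $$ 1 = deriv (rho \<tau>) a"
proof -
  have nz: "theta1 \<tau> a \<noteq> 0" using theta1_zero_imp_lattice[OF Im_tau] assms by blast
  have "open {u. theta1 \<tau> u \<noteq> 0}"
  proof -
    have "continuous_on UNIV (theta1 \<tau>)"
      by (rule holomorphic_on_imp_continuous_on) (rule theta1_holomorphic[OF Im_tau])
    thus ?thesis by (rule open_Collect_neq) (rule continuous_on_const)
  qed
  moreover from this have "rho \<tau> holomorphic_on {u. theta1 \<tau> u \<noteq> 0}"
    by (intro rho_holomorphic[OF Im_tau]) auto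
  ultimately have "rho \<tau> analytic_on {a}" using nz by (auto simp: analytic_at)
  hence fps: "(\<lambda>z. rho \<tau> (a + z)) has_fps_expansion fps_expansion (rho \<tau>) a"
    by (rule analytic_at_imp_has_fps_expansion)
  hence exp: "(\<lambda>z. rho \<tau> (a + z)) has_laurent_expansion fps_to_fls (fps_expansion (rho \<tau>) a)"
    by (rule has_laurent_expansion_fps)
  hence R: "R = fps_to_fls (fps_expansion (rho \<tau>) a)"
    unfolding R_def by (rule laurent_expansion_eqI)
  show "(\<lambda>z. rho \<tau> (a + z)) has_laurent_expansion R" using exp R by simp
  show "R $$ m = 0" if "m < 0" for m using that by (simp add: R)
  show "R $$ 0 = rho \<tau> a" by (simp add: R fps_expansion_def)
  show "R $$ 1 = deriv (rho \<tau>) a" by (simp add: R fps_expansion_def)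
qed

end

lemma has_laurent_expansion_deriv_shift:
  assumes "(\<lambda>z. f (a + z)) has_laurent_expansion F"
  shows   "(\<lambda>z. deriv f (a + z)) has_laurent_expansion fls_deriv F"
proof -
  have "deriv (\<lambda>z. f (a + z)) = (\<lambda>z. deriv f (a + z))"
  proof
    fix z
    show "deriv (\<lambda>z. f (a + z)) z = deriv f (a + z)"
      using deriv_shift_0[of "\<lambda>z. f (a + z)" z] deriv_shift_0[of f "a + z"]
      by (simp add: o_def add.assoc)
  qed
  thus ?thesis using has_laurent_expansion_deriv[OF assms] by simp
qed

section \<open>Evaluation of the intersection numbers\<close>

theorem mainTheorem6:
  fixes \<tau> c0 :: complex and n i :: nat and t c :: "nat \<Rightarrow> complex"
  assumes "Im \<tau> > 0"
    and "n \<ge> 2"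
    and "\<forall>j\<in>{1..n}. \<forall>k\<in>{1..n}. j \<noteq> k \<longrightarrow> t j - t k \<notin> lattice \<tau>"
    and "\<forall>j\<in>{1..n}. c j \<notin> \<int>"
    and "(\<Sum>j=1..n. c j) = 0"
    and "i \<in> {1..n}"
  shows "let I = Ic \<tau> n t c0 c;
             phi0 = (\<lambda>u. 1);
             phi = (\<lambda>j u. if j = i then deriv (rho \<tau>) (u - t i)
                          else rho \<tau> (u - t j) - rho \<tau> (u - t i));
             \<alpha> = 2 * pi * \<i> * c0 + (\<Sum>l\<in>{1..n} - {i}. c l * rho \<tau> (t i - t l))
         in (\<forall>j\<in>{1..n} - {i}. I phi0 (phi j) = 0 \<and> I (phi j) phi0 = 0)
          \<and> (\<forall>j\<in>{1..n} - {i}. \<forall>k\<in>{1..n} - {i}.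
               I (phi j) (phi k) = 2 * pi * \<i> * (1 / c i + (if j = k then 1 / c j else 0)))
          \<and> I (phi i) phi0 = - (2 * pi * \<i>) / (c i - 1)
          \<and> I (phi i) (phi i) = 2 * pi * \<i> / ((c i - 1) * (c i + 1)) *
               (\<alpha>^2 / c i - c i * (deriv ^^ 3) (theta1 \<tau>) 0 / deriv (theta1 \<tau>) 0
                - (\<Sum>l\<in>{1..n} - {i}. c l * deriv (rho \<tau>) (t i - t l)))
          \<and> (\<forall>j\<in>{1..n} - {i}. I (phi i) (phi j) =
               - (2 * pi * \<i>) / (c i * (c i - 1)) * (\<alpha> + c i * rho \<tau> (t i - t j)))"
proof -
  note Im_tau = assms(1)
  let ?J = "{1..n}"
  \<comment> \<open>\<open>L j l\<close> expands \<open>rho \<tau> (u - t l)\<close> at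
    \<open>t j\<close>; on the diagonal it is the expansion at 0.\<close>
  define L where "L = (\<lambda>j l. laurent_expansion (rho \<tau>) (t j - t l))"
  define \<kappa> where "\<kappa> = (deriv ^^ 3) (theta1 \<tau>) 0 / (3 * deriv (theta1 \<tau>) 0)"
  have L: "(\<lambda>z. rho \<tau> (t j - t l + z)) has_laurent_expansion L j l" if "j \<in> ?J" "l \<in> ?J" for j l
    using rho_laurent_expansion_0(1)[OF Im_tau] rho_laurent_expansion_nonlattice(1)[OF Im_tau] assms(3) that
    by (cases "j = l") (auto simp: L_def)
  have L_below: "L j l $$ m = 0" if "j \<in> ?J" "l \<in> ?J" "m < -1" for j l m
    using rho_laurent_expansion_0(2)[OF Im_tau] rho_laurent_expansion_nonlattice(2)[OF Im_tau] assms(3) that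
    by (cases "j = l") (auto simp: L_def)
  have L_m1: "L j l $$ (-1) = (if j = l then 1 else 0)" if "j \<in> ?J" "l \<in> ?J" for j l
    using rho_laurent_expansion_0(3)[OF Im_tau] rho_laurent_expansion_nonlattice(2)[OF Im_tau] assms(3) that
    by (cases "j = l") (auto simp: L_def)
  have L_0: "L j l $$ 0 = (if j = l then 0 else rho \<tau> (t j - t l))" if "j \<in> ?J" "l \<in> ?J" for j l
    using rho_laurent_expansion_0(4)[OF Im_tau] rho_laurent_expansion_nonlattice(3)[OF Im_tau] assms(3) that
    by (cases "j = l") (auto simp: L_def)
  have L_1: "L j l $$ 1 = (if j = l then \<kappa> else deriv (rho \<tau>) (t j - t l))" if "j \<in> ?J" "l \<in> ?J" for j l
    using rho_laurent_expansion_0(5)[OF Im_tau] rho_laurent_expansion_nonlattice(4)[OF Im_tau] assms(3) that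
    by (cases "j = l") (auto simp: L_def \<kappa>_def)

  define W where "W = (\<lambda>j. fls_const (2 * pi * \<i> * c0) + (\<Sum>l\<in>?J. fls_const (c l) * L j l))"
  have W: "(\<lambda>z. omega_coef \<tau> n t c0 c (t j + z)) has_laurent_expansion W j" if "j \<in> ?J" for j
  proof -
    have "(\<lambda>z. 2 * pi * \<i> * c0 + (\<Sum>l\<in>?J. c l * rho \<tau> (t j - t l + z))) has_laurent_expansion W j"
      unfolding W_def by (intro laurent_expansion_intros L that)
    thus ?thesis by (simp add: omega_coef_def algebra_simps)
  qed
  have W_nth: "W j $$ m = (if m = 0 then 2 * pi * \<i> * c0 else 0) + (\<Sum>l\<in>?J. c l * L j l $$ m)" for j m
    by (simp add: W_def fls_nth_sum)
  have W_below: "W j $$ m = 0" if "j \<in> ?J" "m < -1" for j m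
    using that L_below by (simp add: W_nth)
  have W_m1: "W j $$ (-1) = c j" if "j \<in> ?J" for j
  proof -
    have "W j $$ (-1) = (\<Sum>l\<in>?J. c l * L j l $$ (-1))"
      by (simp add: W_nth)
    also have "\<dots> = (\<Sum>l\<in>?J. if j = l then c l else 0)"
      by (intro sum.cong) (use that in \<open>auto simp: L_m1\<close>)
    finally show ?thesis using that by simp
  qed
  have Ic: "Ic \<tau> n t c0 c g k = 2 * pi * \<i> * (\<Sum>j\<in>?J. residue_pairing (W j) (G j) (K j))"
    if "\<And>j. j \<in> ?J \<Longrightarrow> (\<lambda>z. g (t j + z)) has_laurent_expansion G j"
       "\<And>j. j \<in> ?J \<Longrightarrow> (\<lambda>z. k (t j + z)) has_laurent_expansion K j"
       "\<And>j m. j \<in> ?J \<Longrightarrow> m < -2 \<Longrightarrow> G j $$ m = 0"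
       "\<And>j m. j \<in> ?J \<Longrightarrow> m < -2 \<Longrightarrow> K j $$ m = 0" for g k G K
    unfolding Ic_def
    by (intro arg_cong2[of _ _ _ _ "(*)"] refl sum.cong local_residue_eq W that)
       (use W_below W_m1 assms(4) in auto)

  \<comment> \<open>Expansions of the forms at the punctures\<close>
  define phi where "phi = (\<lambda>j u. if j = i then deriv (rho \<tau>) (u - t i)
                          else rho \<tau> (u - t j) - rho \<tau> (u - t i))"
  define \<Phi> where "\<Phi> = (\<lambda>k j. if k = i then fls_deriv (L j i) else L j k - L j i)"
  have \<Phi>: "(\<lambda>z. phi k (t j + z)) has_laurent_expansion \<Phi> k j" if "j \<in> ?J" "k \<in> ?J" for j k
  proof (cases "k = i")
    case True
    thus ?thesis
      using has_laurent_expansion_deriv_shift[OF L[OF \<open>j \<in> ?J\<close> assms(6)]]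
      by (simp add: phi_def \<Phi>_def algebra_simps)
  next
    case False
    have "(\<lambda>z. rho \<tau> (t j - t k + z) - rho \<tau> (t j - t i + z)) has_laurent_expansion L j k - L j i"
      by (intro laurent_expansion_intros L that assms(6))
    thus ?thesis using False by (simp add: phi_def \<Phi>_def algebra_simps)
  qed
  have \<Phi>_below: "\<Phi> k j $$ m = 0" if "j \<in> ?J" "k \<in> ?J" "m < -2" for j k m
    using that L_below assms(6) by (auto simp: \<Phi>_def)
  have one: "(\<lambda>z. (\<lambda>u. 1) (t j + z)) has_laurent_expansion 1" for j by simp
  have one_below: "(1 :: complex fls) $$ m = 0" if "m < -2" for m using that by simp

  \<comment> \<open>The only double pole is that of \<open>phi i\<close> at
    \<open>t i\<close>.\<close>
  have \<Phi>_m2: "\<Phi> k j $$ (-2) = 0" if "j \<in> ?J" "k \<in> ?J" "k \<noteq> i \<or> j \<noteq> i" for j k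
    using that L_below L_m1 assms(6) by (auto simp: \<Phi>_def)
  have \<Phi>_m1: "\<Phi> k j $$ (-1) = (if j = k then 1 else 0) - (if j = i then 1 else 0)"
    if "j \<in> ?J" "k \<in> ?J" "k \<noteq> i" for j k
    using that L_m1 assms(6) by (simp add: \<Phi>_def)
  have \<Phi>_0: "\<Phi> k i $$ 0 = rho \<tau> (t i - t k)" if "k \<in> ?J" "k \<noteq> i" for k
    using that L_0 assms(6) by (simp add: \<Phi>_def)
  have \<Phi>i_m1: "\<Phi> i j $$ (-1) = 0" for j by (simp add: \<Phi>_def)
  \<comment> \<open>Termwise derivative of \<open>1 / z + \<kappa> * z + ...\<close>, hence no
    residue either.\<close>
  have \<Phi>ii: "\<Phi> i i $$ (-2) = -1" "\<Phi> i i $$ 0 = \<kappa>"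
    using L_m1 L_1 assms(6) by (simp_all add: \<Phi>_def)

  \<comment> \<open>Connection coefficients at the double pole\<close>
  define \<alpha> where "\<alpha> = 2 * pi * \<i> * c0 + (\<Sum>l\<in>?J - {i}. c l * rho \<tau> (t i - t l))"
  define \<beta> where "\<beta> = (\<Sum>l\<in>?J - {i}. c l * deriv (rho \<tau>) (t i - t l))"
  have W_0: "W i $$ 0 = \<alpha>"
  proof -
    have "(\<Sum>l\<in>?J. c l * L i l $$ 0) = c i * L i i $$ 0 + (\<Sum>l\<in>?J - {i}. c l * L i l $$ 0)"
      by (rule sum.remove) (use assms(6) in auto)
    also have "(\<Sum>l\<in>?J - {i}. c l * L i l $$ 0) = (\<Sum>l\<in>?J - {i}. c l * rho \<tau> (t i - t l))"
      by (intro sum.cong) (use L_0 assms(6) in auto)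
    finally show ?thesis using L_0 assms(6) by (simp add: W_nth \<alpha>_def)
  qed
  have W_1: "W i $$ 1 = c i * \<kappa> + \<beta>"
  proof -
    have "(\<Sum>l\<in>?J. c l * L i l $$ 1) = c i * L i i $$ 1 + (\<Sum>l\<in>?J - {i}. c l * L i l $$ 1)"
      by (rule sum.remove) (use assms(6) in auto)
    also have "(\<Sum>l\<in>?J - {i}. c l * L i l $$ 1) = (\<Sum>l\<in>?J - {i}. c l * deriv (rho \<tau>) (t i - t l))"
      by (intro sum.cong) (use L_1 assms(6) in auto)
    finally show ?thesis using L_1 assms(6) by (simp add: W_nth \<beta>_def)
  qed

  have ci: "c i \<noteq> 0" "c i - 1 \<noteq> 0" "c i + 1 \<noteq> 0"
  proof -
    have "c i \<notin> \<int>" using assms(4,6) by blast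
    thus "c i \<noteq> 0" "c i - 1 \<noteq> 0" "c i + 1 \<noteq> 0" by (auto simp: add_eq_0_iff2)
  qed

  \<comment> \<open>Pairings among the forms without double poles\<close>
  have phi0_phi: "Ic \<tau> n t c0 c (\<lambda>u. 1) (phi j) = 0" if "j \<in> ?J - {i}" for j
  proof -
    have "Ic \<tau> n t c0 c (\<lambda>u. 1) (phi j) = 2 * pi * \<i> * (\<Sum>l\<in>?J. residue_pairing (W l) 1 (\<Phi> j l))"
      by (rule Ic) (use one one_below \<Phi> \<Phi>_below that in auto)
    \<comment> \<open>The solution for the form \<open>du\<close> starts with \<open>z\<close>,
      which meets only a double pole, and \<open>phi j\<close> has none.\<close>
    also have "(\<Sum>l\<in>?J. residue_pairing (W l) 1 (\<Phi> j l)) = 0"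
      by (rule sum.neutral) (use \<Phi>_m2 that in \<open>auto simp: residue_pairing_def Let_def\<close>)
    finally show ?thesis by simp
  qed
  have phi_phi0: "Ic \<tau> n t c0 c (phi j) (\<lambda>u. 1) = 0" if "j \<in> ?J - {i}" for j
  proof -
    have "Ic \<tau> n t c0 c (phi j) (\<lambda>u. 1) = 2 * pi * \<i> * (\<Sum>l\<in>?J. residue_pairing (W l) (\<Phi> j l) 1)"
      by (rule Ic) (use one one_below \<Phi> \<Phi>_below that in auto)
    \<comment> \<open>Against the constant 1 only the polar part of the solution counts, and it is
      zero for a simple pole of the form.\<close>
    also have "(\<Sum>l\<in>?J. residue_pairing (W l) (\<Phi> j l) 1) = 0"
      by (rule sum.neutral) (use \<Phi>_m2 that in \<open>auto simp: residue_pairing_def Let_def\<close>)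
    finally show ?thesis by simp
  qed
  have phi_phi: "Ic \<tau> n t c0 c (phi j) (phi k) = 2 * pi * \<i> * (1 / c i + (if j = k then 1 / c j else 0))"
    if jk: "j \<in> ?J - {i}" "k \<in> ?J - {i}" for j k
  proof -
    have "Ic \<tau> n t c0 c (phi j) (phi k) = 2 * pi * \<i> * (\<Sum>l\<in>?J. residue_pairing (W l) (\<Phi> j l) (\<Phi> k l))"
      by (rule Ic) (use \<Phi> \<Phi>_below that in auto)
    \<comment> \<open>Each puncture contributes the product of residues over \<open>c l\<close>. The
      residues of \<open>phi j\<close> are 1 at \<open>t j\<close> and -1 at \<open>t i\<close>, so
      \<open>t i\<close> always contributes and \<open>t j\<close> only if
      \<open>j = k\<close>.\<close>
    also have "(\<Sum>l\<in>?J. residue_pairing (W l) (\<Phi> j l) (\<Phi> k l)) =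
                 (\<Sum>l\<in>?J. (if l = i then 1 / c l else 0) +
                    (if l = j then (if j = k then 1 / c l else 0) else 0))"
    proof (rule sum.cong)
      fix l assume l: "l \<in> ?J"
      have "residue_pairing (W l) (\<Phi> j l) (\<Phi> k l) = \<Phi> j l $$ (-1) * \<Phi> k l $$ (-1) / c l"
        using \<Phi>_m2 jk l by (simp add: residue_pairing_def Let_def W_m1)
      also have "\<dots> = (if l = i then 1 / c l else 0) +
                       (if l = j then (if j = k then 1 / c l else 0) else 0)"
        using \<Phi>_m1 jk l by auto
      finally show "residue_pairing (W l) (\<Phi> j l) (\<Phi> k l) = (if l = i then 1 / c l else 0) +
                       (if l = j then (if j = k then 1 / c l else 0) else 0)" .
    qed auto
    also have "\<dots> = 1 / c i + (if j = k then 1 / c j else 0)"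
      using jk assms(6) by (simp add: sum.distrib)
    finally show ?thesis .
  qed

  \<comment> \<open>Away from \<open>t i\<close> the form \<open>phi i\<close> is regular, so its
    solution starts with \<open>z\<close> and pairs to zero unless \<open>K l\<close> has a double
    pole.\<close>
  have at_i: "(\<Sum>l\<in>?J. residue_pairing (W l) (\<Phi> i l) (K l)) = residue_pairing (W i) (\<Phi> i i) (K i)"
    if "\<And>l. l \<in> ?J - {i} \<Longrightarrow> K l $$ (-2) = 0" for K
  proof -
    have "(\<Sum>l\<in>?J. residue_pairing (W l) (\<Phi> i l) (K l)) =
            residue_pairing (W i) (\<Phi> i i) (K i) + (\<Sum>l\<in>?J - {i}. residue_pairing (W l) (\<Phi> i l) (K l))"
      by (rule sum.remove) (use assms(6) in auto)
    also have "(\<Sum>l\<in>?J - {i}. residue_pairing (W l) (\<Phi> i l) (K l)) = 0"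
      by (rule sum.neutral)
         (use \<Phi>_m2 \<Phi>i_m1 that assms(6) in \<open>auto simp: residue_pairing_def Let_def\<close>)
    finally show ?thesis by simp
  qed
  \<comment> \<open>The solution at \<open>t i\<close> has the coefficients
    \<open>-1 / (c i - 1)\<close>, then \<open>\<alpha> / (c i * (c i - 1))\<close>, then the one in
    front of \<open>K $$ (-2)\<close>.\<close>
  have pairing_i: "residue_pairing (W i) (\<Phi> i i) K =
      - K $$ 0 / (c i - 1) + \<alpha> / (c i * (c i - 1)) * K $$ (-1)
      + (\<kappa> - \<alpha>^2 / (c i * (c i - 1)) + (c i * \<kappa> + \<beta>) / (c i - 1)) / (c i + 1) * K $$ (-2)" for K
    using assms(6) by (simp add: residue_pairing_def Let_def W_m1 W_0 W_1 \<Phi>ii \<Phi>i_m1 power2_eq_square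
      mult.commute[of "c i - 1" "c i"])

  have phii_phi0: "Ic \<tau> n t c0 c (phi i) (\<lambda>u. 1) = - (2 * pi * \<i>) / (c i - 1)"
  proof -
    have "Ic \<tau> n t c0 c (phi i) (\<lambda>u. 1) = 2 * pi * \<i> * (\<Sum>l\<in>?J. residue_pairing (W l) (\<Phi> i l) 1)"
      by (rule Ic) (use one one_below \<Phi> \<Phi>_below assms(6) in auto)
    also have "(\<Sum>l\<in>?J. residue_pairing (W l) (\<Phi> i l) 1) = residue_pairing (W i) (\<Phi> i i) 1"
      by (rule at_i) simp
    finally show ?thesis by (simp add: pairing_i)
  qed
  have phii_phi: "Ic \<tau> n t c0 c (phi i) (phi j) =
          - (2 * pi * \<i>) / (c i * (c i - 1)) * (\<alpha> + c i * rho \<tau> (t i - t j))" if "j \<in> ?J - {i}" for j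
  proof -
    have "Ic \<tau> n t c0 c (phi i) (phi j) = 2 * pi * \<i> * (\<Sum>l\<in>?J. residue_pairing (W l) (\<Phi> i l) (\<Phi> j l))"
      by (rule Ic) (use \<Phi> \<Phi>_below assms(6) that in auto)
    also have "(\<Sum>l\<in>?J. residue_pairing (W l) (\<Phi> i l) (\<Phi> j l)) = residue_pairing (W i) (\<Phi> i i) (\<Phi> j i)"
      by (rule at_i) (use \<Phi>_m2 that in auto)
    also have "\<dots> = - rho \<tau> (t i - t j) / (c i - 1) - \<alpha> / (c i * (c i - 1))"
      using that assms(6) \<Phi>_m2 \<Phi>_m1 \<Phi>_0 by (simp add: pairing_i)
    also have "\<dots> = - ((\<alpha> + c i * rho \<tau> (t i - t j)) / (c i * (c i - 1)))"
      using ci by (simp add: add_divide_distrib diff_divide_distrib)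
    finally show ?thesis by simp
  qed
  have phii_phii: "Ic \<tau> n t c0 c (phi i) (phi i) = 2 * pi * \<i> / ((c i - 1) * (c i + 1)) *
               (\<alpha>^2 / c i - c i * (deriv ^^ 3) (theta1 \<tau>) 0 / deriv (theta1 \<tau>) 0 - \<beta>)"
  proof -
    have "Ic \<tau> n t c0 c (phi i) (phi i) = 2 * pi * \<i> * (\<Sum>l\<in>?J. residue_pairing (W l) (\<Phi> i l) (\<Phi> i l))"
      by (rule Ic) (use \<Phi> \<Phi>_below assms(6) in auto)
    also have "(\<Sum>l\<in>?J. residue_pairing (W l) (\<Phi> i l) (\<Phi> i l)) = residue_pairing (W i) (\<Phi> i i) (\<Phi> i i)"
      by (rule at_i) (use \<Phi>_m2 assms(6) in auto)
    also have "\<dots> = - \<kappa> / (c i - 1) -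
                 (\<kappa> - \<alpha>^2 / (c i * (c i - 1)) + (c i * \<kappa> + \<beta>) / (c i - 1)) / (c i + 1)"
      unfolding pairing_i by (simp add: \<Phi>ii \<Phi>i_m1)
    \<comment> \<open>Over the common denominator the terms in \<open>\<kappa>\<close> add up to
      \<open>-(c i + 1) - (c i - 1) - c i = -3 * c i\<close>; the 3 cancels the one in the
      definition of \<open>\<kappa>\<close>.\<close>
    also have "\<dots> = (\<alpha>^2 / c i - c i * (3 * \<kappa>) - \<beta>) / ((c i - 1) * (c i + 1))"
      using ci by (simp add: divide_simps) (simp add: algebra_simps)
    also have "c i * (3 * \<kappa>) = c i * (deriv ^^ 3) (theta1 \<tau>) 0 / deriv (theta1 \<tau>) 0"
      by (simp add: \<kappa>_def)
    finally show ?thesis by simp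
  qed

  show ?thesis
    unfolding Let_def phi_def [symmetric] \<alpha>_def [symmetric] \<beta>_def [symmetric]
    using phi0_phi phi_phi0 phi_phi phii_phi0 phii_phi phii_phii by blast
qed

end
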